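(* Let $g$ be a $\lambda$-independent automorphism of the auxiliary space admitting a logarithm (ad-factorizable in the spectral-parameter case), $b(\lambda)$, $q(\lambda)$ invertible one-space dynamical matrices, and $R^0_{12}$, $\bar R_{12}$ non-dynamical two-space matrices with $R^0_{12}R^{0\,gg}_{13}R^0_{23}=R^{0\,gg}_{23}R^0_{13}R^{0\,gg}_{12}$ and likewise for $\bar R$. Put $\sigma=\sum_{i=1}^n\lambda_i$, $G=e^{\sigma(\log g_1+\log g_2)}$, and $$A_{12}=b_1^{-1}(g_2b_2g_2^{-1})^{-1}\,\{G^{-1}R^0_{12}G\}\,(g_1b_1g_1^{-1})\,b_2,\quad B_{12}=b_2^{-1}g_2\,b_2(h_1)\,g_2^{-1},\quad C_{12}=b_1^{-1}g_1\,b_1(h_2)\,g_1^{-1},$$ $$D_{12}=q_1(h_2)^{-1}\,q_2^{-1}\,\{G^{-1}\bar R_{12}G\}\,q_1\,q_2(h_1).$$ If $\mathcal Q^0$ is a non-dynamical solution of $$R^0_{12}\,\mathcal Q^0_1\,g_2^{-1}\mathcal Q^0_2\,g_2=\mathcal Q^0_2\,g_1^{-1}\mathcal Q^0_1\,g_1\,\bar R_{12},$$ then $$K=g\,b^{-1}g^{-1}\Big(e^{-\sigma\log g}\,\mathcal Q^0\,e^{\sigma\log g}\Big)\,q$$ is a solution of the semi-dynamical reflection equation $$A_{12}\,K_1\,B_{12}\,K_2(h_1)=K_2\,C_{12}\,K_1(h_2)\,D_{12}.$$ If $R^0=\bar R$, there exists at least one invertible such $\mathcal Q^0$, namely $\mathcal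 Q^0=1$, and $k=g\,b^{-1}g^{-1}q$ is an invertible scalar solution of the semi-dynamical reflection equation.
   Context: Setting. Fix $n\ge 1$, $V=\mathbb C^n$ with matrix units $e_{ij}$; $h_i=e_{ii}$ is the basis of the Cartan subalgebra $\mathfrak h$ of $gl(n)$; $\lambda\in\mathbb C^n$ are the dynamical variables; $\epsilon_i$ is the $i$-th standard basis vector; the shift step is normalized to $\gamma=1$. The auxiliary space $\mathcal V$ is $V$, or $V\otimes\mathbb C[[u]]$, in which case matrices have coefficients in formal power series and space $j$ carries the parameter $u_j$. A "dynamical matrix" is a scalar (c-number) function of $\lambda$ with values in $\mathrm{End}(V)$ (one-space) or $\mathrm{End}(V)\otimes\mathrm{End}(V)$ (two-space), possibly with power series coefficients; invertible means invertible for every $\lambda$. $\mathcal Q^0$ and $K$ may be scalar or have entries in an associative unital $\mathbb C$-algebra (operatorial case), in which scalars are central. Subscripts indicate the tensor factors in which an operator acts; the argument $\lambda$ is omitted. "Non-dynamical" means invariant under $\lambda\mapsto\lambda+\epsilon_i$ for every $i$. Automorphism $g$. $g$ is an invertible operator on $\mathcal V$, independent of $\lambda$, with an operator $\log g$ on $\mathcal V$ such that $\exp(\log g)=g$; $e^{s\log g}$, $s\in\mathbb C$, is the corresponding one-parameter group. If $\mathcal V=V\otimes\mathbb C[[u]]$, $g$ is ad-factorizable: conjugation by $g$ and by $e^{s\log g}$ maps matrices in $\mathrm{End}(V)^{\otimes N}\otimes\mathbb C[[u_1,\dots,u_N]]$ to matrices of the same kind. Notation: $X_{ab}^{gg}=g_ag_bX_{ab}g_a^{-1}g_b^{-1}$.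 Dynamical shift. If $f(\lambda)$ does not act in space $a$, then $f(h_a)=f(\lambda+h_a):=\sum_{i=1}^n f(\lambda+\epsilon_i)(e_{ii})_a$. *)

theory Defs
  imports "HOL-Analysis.Analysis"
begin

section \<open>Operators\<close>

text \<open>
  An operator with coefficients in \<open>'a\<close> is given by its matrix with respect to a basis (or, for
  power series, a topological basis) indexed by \<open>'s\<close>. Every row is finite, which is what is needed
  to act on all families of coefficients indexed by \<open>'s\<close>, in particular on all power series, and
  to act in one factor of a (completed) tensor product: that factor is one component of the index.
\<close>

typedef (overloaded) ('s, 'a::zero) oper =
  "{X :: 's \<Rightarrow> 's \<Rightarrow> 'a. \<forall>x. finite {y. X x y \<noteq> 0}}"
  morphisms entry Abs_oper
  by (rule exI[of _ "\<lambda>_ _. 0"]) simp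

setup_lifting type_definition_oper

lemma finite_row: "finite {y. entry X x y \<noteq> 0}"
  using entry[of X] by simp

lemma oper_eqI: "(\<And>x y. entry X x y = entry Y x y) \<Longrightarrow> X = Y"
  by (metis entry_inject ext)

lemma finite_row_prod:
  fixes X Y :: "'s \<Rightarrow> 's \<Rightarrow> 'a::semiring_0"
  assumes "\<And>x. finite {y. X x y \<noteq> 0}" and "\<And>x. finite {y. Y x y \<noteq> 0}"
  shows "finite {z. (\<Sum>y | X x y \<noteq> 0. X x y * Y y z) \<noteq> 0}"
proof (rule finite_subset)
  show "{z. (\<Sum>y | X x y \<noteq> 0. X x y * Y y z) \<noteq> 0}
      \<subseteq> (\<Union>y\<in>{y. X x y \<noteq> 0}. {z. Y y z \<noteq> 0})"
  proof
    fix z assume "z \<in> {z. (\<Sum>y | X x y \<noteq> 0. X x y * Y y z) \<noteq> 0}"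
    then have "(\<Sum>y | X x y \<noteq> 0. X x y * Y y z) \<noteq> 0" by simp
    then obtain y where "y \<in> {y. X x y \<noteq> 0}" "X x y * Y y z \<noteq> 0"
      by (meson sum.not_neutral_contains_not_neutral)
    then show "z \<in> (\<Union>y\<in>{y. X x y \<noteq> 0}. {z. Y y z \<noteq> 0})" by auto
  qed
  show "finite (\<Union>y\<in>{y. X x y \<noteq> 0}. {z. Y y z \<noteq> 0})"
    using assms by blast
qed

instantiation oper :: (type, ring_1) ring_1
begin

lift_definition zero_oper :: "('a, 'b) oper" is "\<lambda>_ _. 0" by simp

lift_definition one_oper :: "('a, 'b) oper" is "\<lambda>x y. if x = y then 1 else 0" by simp

lift_definition plus_oper :: "('a, 'b) oper \<Rightarrow> ('a, 'b) oper \<Rightarrow> ('a, 'b) oper"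
  is "\<lambda>X Y x y. X x y + Y x y"
proof -
  fix X Y :: "'a \<Rightarrow> 'a \<Rightarrow> 'b" and x
  assume *: "\<And>x. finite {y. X x y \<noteq> 0}" "\<And>x. finite {y. Y x y \<noteq> 0}"
  have "{y. X x y + Y x y \<noteq> 0} \<subseteq> {y. X x y \<noteq> 0} \<union> {y. Y x y \<noteq> 0}" by auto
  then show "finite {y. X x y + Y x y \<noteq> 0}"
    by (rule finite_subset) (use * in simp)
qed

lift_definition minus_oper :: "('a, 'b) oper \<Rightarrow> ('a, 'b) oper \<Rightarrow> ('a, 'b) oper"
  is "\<lambda>X Y x y. X x y - Y x y"
proof -
  fix X Y :: "'a \<Rightarrow> 'a \<Rightarrow> 'b" and x
  assume *: "\<And>x. finite {y. X x y \<noteq> 0}" "\<And>x. finite {y. Y x y \<noteq> 0}"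
  have "{y. X x y - Y x y \<noteq> 0} \<subseteq> {y. X x y \<noteq> 0} \<union> {y. Y x y \<noteq> 0}" by auto
  then show "finite {y. X x y - Y x y \<noteq> 0}"
    by (rule finite_subset) (use * in simp)
qed

lift_definition uminus_oper :: "('a, 'b) oper \<Rightarrow> ('a, 'b) oper"
  is "\<lambda>X x y. - X x y" by simp

lift_definition times_oper :: "('a, 'b) oper \<Rightarrow> ('a, 'b) oper \<Rightarrow> ('a, 'b) oper"
  is "\<lambda>X Y x z. \<Sum>y | X x y \<noteq> 0. X x y * Y y z"
  by (rule finite_row_prod)

lemma entry_times:
  assumes "finite S" "{y. entry X x y \<noteq> 0} \<subseteq> S"
  shows "entry (X * Y) x z = (\<Sum>y\<in>S. entry X x y * entry Y y z)"
  unfolding times_oper.rep_eq using assms by (intro sum.mono_neutral_left) auto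

instance
proof
  fix X Y Z :: "('a, 'b) oper"
  show "X + Y + Z = X + (Y + Z)" by transfer (simp add: add.assoc)
  show "X + Y = Y + X" by transfer (simp add: add.commute)
  show "0 + X = X" by transfer simp
  show "- X + X = 0" by transfer simp
  show "X - Y = X + - Y" by transfer simp
  show "(0 :: ('a, 'b) oper) \<noteq> 1" by transfer (metis zero_neq_one)
  show "1 * X = X" by transfer (auto simp: fun_eq_iff)
  show "X * 1 = X"
  proof (rule oper_eqI)
    fix x z
    obtain S where S: "finite S" "{y. entry X x y \<noteq> 0} \<subseteq> S" "z \<in> S"
      by (rule that[of "insert z {y. entry X x y \<noteq> 0}"]) (auto simp: finite_row)
    have "entry (X * 1) x z = (\<Sum>y\<in>S. entry X x y * entry 1 y z)"
      by (rule entry_times[OF S(1,2)])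
    also have "\<dots> = entry X x z"
      using S by (simp add: one_oper.rep_eq mult_delta_right)
    finally show "entry (X * 1) x z = entry X x z" .
  qed
  show "(X + Y) * Z = X * Z + Y * Z"
  proof (rule oper_eqI)
    fix x z
    let ?S = "{y. entry X x y \<noteq> 0} \<union> {y. entry Y x y \<noteq> 0}"
    have f: "finite ?S" by (simp add: finite_row)
    have "entry ((X + Y) * Z) x z = (\<Sum>y\<in>?S. entry (X + Y) x y * entry Z y z)"
      by (rule entry_times[OF f]) (auto simp: plus_oper.rep_eq)
    also have "\<dots> = entry (X * Z + Y * Z) x z"
      by (simp add: plus_oper.rep_eq entry_times[OF f] distrib_right sum.distrib)
    finally show "entry ((X + Y) * Z) x z = entry (X * Z + Y * Z) x z" .
  qed
  show "X * (Y + Z) = X * Y + X * Z"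
    by (rule oper_eqI) (simp add: plus_oper.rep_eq times_oper.rep_eq distrib_left sum.distrib)
  show "X * Y * Z = X * (Y * Z)"
  proof (rule oper_eqI)
    fix x z
    let ?S = "{y. entry X x y \<noteq> 0}"
    let ?T = "\<Union>y\<in>?S. {w. entry Y y w \<noteq> 0}"
    have S: "finite ?S" and T: "finite ?T" by (auto simp: finite_row)
    have sub: "{w. entry (X * Y) x w \<noteq> 0} \<subseteq> ?T"
    proof
      fix w assume "w \<in> {w. entry (X * Y) x w \<noteq> 0}"
      then have "(\<Sum>y\<in>?S. entry X x y * entry Y y w) \<noteq> 0" by (simp add: times_oper.rep_eq)
      then obtain y where "y \<in> ?S" "entry X x y * entry Y y w \<noteq> 0"
        by (meson sum.not_neutral_contains_not_neutral)
      then show "w \<in> ?T" by auto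
    qed
    have "entry (X * Y * Z) x z = (\<Sum>w\<in>?T. entry (X * Y) x w * entry Z w z)"
      by (rule entry_times[OF T sub])
    also have "\<dots> = (\<Sum>w\<in>?T. \<Sum>y\<in>?S. entry X x y * entry Y y w * entry Z w z)"
      by (simp add: times_oper.rep_eq[of X Y] sum_distrib_right)
    also have "\<dots> = (\<Sum>y\<in>?S. \<Sum>w\<in>?T. entry X x y * entry Y y w * entry Z w z)"
      by (rule sum.swap)
    also have "\<dots> = (\<Sum>y\<in>?S. entry X x y * entry (Y * Z) y z)"
    proof (rule sum.cong[OF refl])
      fix y assume "y \<in> ?S"
      then have "entry (Y * Z) y z = (\<Sum>w\<in>?T. entry Y y w * entry Z w z)"
        by (intro entry_times[OF T]) auto
      then show "(\<Sum>w\<in>?T. entry X x y * entry Y y w * entry Z w z)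
          = entry X x y * entry (Y * Z) y z"
        by (simp add: sum_distrib_left mult.assoc)
    qed
    also have "\<dots> = entry (X * (Y * Z)) x z"
      by (simp add: times_oper.rep_eq[of X "Y * Z"])
    finally show "entry (X * Y * Z) x z = entry (X * (Y * Z)) x z" .
  qed
qed

end

definition op_invertible :: "('s, 'a::ring_1) oper \<Rightarrow> bool" where
  "op_invertible X \<longleftrightarrow> (\<exists>Y. X * Y = 1 \<and> Y * X = 1)"

definition op_inv :: "('s, 'a::ring_1) oper \<Rightarrow> ('s, 'a) oper" where
  "op_inv X = (THE Y. X * Y = 1 \<and> Y * X = 1)"

lift_definition op_scale :: "complex \<Rightarrow> ('s, complex) oper \<Rightarrow> ('s, complex) oper"
  is "\<lambda>c X x y. c * X x y"
proof -
  fix c and X :: "'s \<Rightarrow> 's \<Rightarrow> complex" and x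
  assume "\<And>x. finite {y. X x y \<noteq> 0}"
  moreover have "{y. c * X x y \<noteq> 0} \<subseteq> {y. X x y \<noteq> 0}" by auto
  ultimately show "finite {y. c * X x y \<noteq> 0}" by (rule rev_finite_subset)
qed


subsection \<open>Exponential and logarithm\<close>

definition op_exp :: "('s, complex) oper \<Rightarrow> ('s, complex) oper" where
  "op_exp L = Abs_oper (\<lambda>x y. \<Sum>k. entry (L ^ k) x y / fact k)"

text \<open>The exponential series converges entrywise to an operator. For finite \<open>'s\<close> this always holds.\<close>

definition exponentiable :: "('s, complex) oper \<Rightarrow> bool" where
  "exponentiable L \<longleftrightarrow>
     (\<forall>x y. summable (\<lambda>k. entry (L ^ k) x y / fact k)) \<and>
     (\<forall>x. finite {y. (\<Sum>k. entry (L ^ k) x y / fact k) \<noteq> 0})"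

definition is_log :: "('s, complex) oper \<Rightarrow> ('s, complex) oper \<Rightarrow> bool" where
  "is_log L g \<longleftrightarrow> (\<forall>s. exponentiable (op_scale s L)) \<and> op_exp L = g"


section \<open>Coefficients in an associative unital complex algebra\<close>

class complex_algebra_1 = ring_1 +
  fixes of_cplx :: "complex \<Rightarrow> 'a"
  assumes of_cplx_1: "of_cplx 1 = 1"
    and of_cplx_add: "of_cplx (x + y) = of_cplx x + of_cplx y"
    and of_cplx_mult: "of_cplx (x * y) = of_cplx x * of_cplx y"
    and of_cplx_central: "of_cplx x * a = a * of_cplx x"
begin

lemma of_cplx_0: "of_cplx 0 = 0"
  using of_cplx_add[of 0 0] by simp

end

instantiation complex :: complex_algebra_1
begin

definition of_cplx_complex :: "complex \<Rightarrow> complex" where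
  "of_cplx_complex x = x"

instance
  by standard (simp_all add: of_cplx_complex_def mult.commute)

end

lift_definition emb :: "('s, complex) oper \<Rightarrow> ('s, 'a::complex_algebra_1) oper"
  is "\<lambda>X x y. of_cplx (X x y)"
proof -
  fix X :: "'s \<Rightarrow> 's \<Rightarrow> complex" and x
  assume "\<And>x. finite {y. X x y \<noteq> 0}"
  moreover have "{y. (of_cplx (X x y) :: 'a) \<noteq> 0} \<subseteq> {y. X x y \<noteq> 0}"
    by (auto simp: of_cplx_0)
  ultimately show "finite {y. (of_cplx (X x y) :: 'a) \<noteq> 0}" by (rule rev_finite_subset)
qed


section \<open>Tensor factors\<close>

lift_definition leg1 :: "('s, 'a::zero) oper \<Rightarrow> ('s \<times> 's, 'a) oper"
  is "\<lambda>X (x1, x2) (y1, y2). if x2 = y2 then X x1 y1 else 0"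
  subgoal for X p
    by (rule finite_subset[of _ "{y. X (fst p) y \<noteq> 0} \<times> {snd p}"])
      (auto split: if_splits prod.splits)
  done

lift_definition leg2 :: "('s, 'a::zero) oper \<Rightarrow> ('s \<times> 's, 'a) oper"
  is "\<lambda>X (x1, x2) (y1, y2). if x1 = y1 then X x2 y2 else 0"
  subgoal for X p
    by (rule finite_subset[of _ "{fst p} \<times> {y. X (snd p) y \<noteq> 0}"])
      (auto split: if_splits prod.splits)
  done

lift_definition leg12 :: "('s \<times> 's, 'a::zero) oper \<Rightarrow> ('s \<times> 's \<times> 's, 'a) oper"
  is "\<lambda>X (x1, x2, x3) (y1, y2, y3). if x3 = y3 then X (x1, x2) (y1, y2) else 0"
  subgoal for X p
    by (cases p, rule finite_subset[of _ "let S = {y. X (fst p, fst (snd p)) y \<noteq> 0} in fst ` S \<times> snd ` S \<times> {snd (snd p)}"])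
      (auto simp: Let_def split: if_splits intro: rev_image_eqI)
  done

lift_definition leg13 :: "('s \<times> 's, 'a::zero) oper \<Rightarrow> ('s \<times> 's \<times> 's, 'a) oper"
  is "\<lambda>X (x1, x2, x3) (y1, y2, y3). if x2 = y2 then X (x1, x3) (y1, y3) else 0"
  subgoal for X p
    by (cases p, rule finite_subset[of _ "let S = {y. X (fst p, snd (snd p)) y \<noteq> 0} in fst ` S \<times> {fst (snd p)} \<times> snd ` S"])
      (auto simp: Let_def split: if_splits intro: rev_image_eqI)
  done

lift_definition leg23 :: "('s \<times> 's, 'a::zero) oper \<Rightarrow> ('s \<times> 's \<times> 's, 'a) oper"
  is "\<lambda>X (x1, x2, x3) (y1, y2, y3). if x1 = y1 then X (x2, x3) (y2, y3) else 0"
  subgoal for X p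
    by (cases p, rule finite_subset[of _ "{fst p} \<times> {y. X (snd p) y \<noteq> 0}"])
      (auto split: if_splits)
  done


section \<open>Auxiliary space and matrices\<close>

text \<open>
  The auxiliary space has index type \<open>'n \<times> 'm\<close>, where \<open>(i, k)\<close> stands for the basis vector
  \<open>i\<close> of \<open>V\<close> times the monomial \<open>u\<^sup>k\<close>. With \<open>'m = unit\<close> it is \<open>V\<close> itself, with \<open>'m = nat\<close> it is
  \<open>V \<otimes> \<complex>[[u]]\<close>. These are the two intended instances of the class of exponents.
\<close>

class spectral_exponent = ordered_cancel_comm_monoid_diff +
  assumes finite_below: "finite {l. l \<le> k}"

instance nat :: spectral_exponent
  by standard simp

instantiation unit :: spectral_exponent
begin

definition zero_unit :: unit where "zero_unit = ()"
definition plus_unit :: "unit \<Rightarrow> unit \<Rightarrow> unit" where "plus_unit _ _ = ()"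
definition minus_unit :: "unit \<Rightarrow> unit \<Rightarrow> unit" where "minus_unit _ _ = ()"

instance by standard auto

end

text \<open>
  Among the operators, the matrices are the multiplications by a matrix with power series
  coefficients \<open>c i j = \<Sum>\<^sub>d c i j d u\<^sup>d\<close>. For \<open>'m = unit\<close> every operator is a matrix.
\<close>

definition one_space_matrix :: "('n::finite \<times> 'm::spectral_exponent, 'a::zero) oper \<Rightarrow> bool" where
  "one_space_matrix X \<longleftrightarrow> (\<exists>c :: 'n \<Rightarrow> 'n \<Rightarrow> 'm \<Rightarrow> 'a. \<forall>i k j l.
     entry X (i, k) (j, l) = (if l \<le> k then c i j (k - l) else 0))"

definition two_space_matrix ::
  "(('n::finite \<times> 'm::spectral_exponent) \<times> ('n \<times> 'm), 'a::zero) oper \<Rightarrow> bool" where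
  "two_space_matrix X \<longleftrightarrow> (\<exists>c :: 'n \<Rightarrow> 'n \<Rightarrow> 'n \<Rightarrow> 'n \<Rightarrow> 'm \<Rightarrow> 'm \<Rightarrow> 'a. \<forall>i1 k1 i2 k2 j1 l1 j2 l2.
     entry X ((i1, k1), (i2, k2)) ((j1, l1), (j2, l2)) =
       (if l1 \<le> k1 \<and> l2 \<le> k2 then c i1 i2 j1 j2 (k1 - l1) (k2 - l2) else 0))"

text \<open>
  Conjugation by \<open>e\<^bsup>s log g\<^esup>\<close> (for \<open>s = 1\<close>: by \<open>g\<close>). The condition for one space implies the one for
  conjugation in any factor of \<open>N\<close> spaces and for arbitrary coefficient algebras, because
  conjugation in space \<open>a\<close> acts blockwise with respect to the indices of the other spaces.
\<close>

definition ad_factorizable :: "('n::finite \<times> 'm::spectral_exponent, complex) oper \<Rightarrow> bool" where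
  "ad_factorizable L \<longleftrightarrow> (\<forall>s X. one_space_matrix X \<longrightarrow>
     one_space_matrix (op_exp (op_scale s L) * X * op_inv (op_exp (op_scale s L))))"


section \<open>Dynamical matrices\<close>

definition dyn_matrix1 ::
  "(complex ^ 'n::finite \<Rightarrow> ('n \<times> 'm::spectral_exponent, 'a::zero) oper) \<Rightarrow> bool" where
  "dyn_matrix1 f \<longleftrightarrow> (\<forall>lam. one_space_matrix (f lam))"

definition dyn_matrix2 ::
  "(complex ^ 'n::finite \<Rightarrow> (('n \<times> 'm::spectral_exponent) \<times> ('n \<times> 'm), 'a::zero) oper) \<Rightarrow> bool" where
  "dyn_matrix2 f \<longleftrightarrow> (\<forall>lam. two_space_matrix (f lam))"

definition invertible_dyn_matrix1 ::
  "(complex ^ 'n::finite \<Rightarrow> ('n \<times> 'm::spectral_exponent, 'a::ring_1) oper) \<Rightarrow> bool" where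
  "invertible_dyn_matrix1 f \<longleftrightarrow> dyn_matrix1 f \<and>
     (\<forall>lam. \<exists>Y. one_space_matrix Y \<and> f lam * Y = 1 \<and> Y * f lam = 1)"

definition nondynamical :: "(complex ^ 'n::finite \<Rightarrow> 'b) \<Rightarrow> bool" where
  "nondynamical f \<longleftrightarrow> (\<forall>i lam. f (lam + axis i 1) = f lam)"

lift_definition e_diag :: "'n \<Rightarrow> ('n::finite \<times> 'm::spectral_exponent, 'a::ring_1) oper"
  is "\<lambda>i x y. if x = y \<and> fst x = i then 1 else 0"
  by (auto intro: finite_subset[of _ "{x}" for x])

definition shift_h1 ::
  "(complex ^ 'n::finite \<Rightarrow> (('n \<times> 'm::spectral_exponent) \<times> ('n \<times> 'm), 'a::ring_1) oper) \<Rightarrow>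
   complex ^ 'n \<Rightarrow> (('n \<times> 'm) \<times> ('n \<times> 'm), 'a) oper" where
  "shift_h1 f lam = (\<Sum>i\<in>UNIV. f (lam + axis i 1) * leg1 (e_diag i))"

definition shift_h2 ::
  "(complex ^ 'n::finite \<Rightarrow> (('n \<times> 'm::spectral_exponent) \<times> ('n \<times> 'm), 'a::ring_1) oper) \<Rightarrow>
   complex ^ 'n \<Rightarrow> (('n \<times> 'm) \<times> ('n \<times> 'm), 'a) oper" where
  "shift_h2 f lam = (\<Sum>i\<in>UNIV. f (lam + axis i 1) * leg2 (e_diag i))"

definition sigma :: "complex ^ 'n::finite \<Rightarrow> complex" where
  "sigma lam = (\<Sum>i\<in>UNIV. lam $ i)"


section \<open>Equations\<close>

definition conj_gg :: "('s, 'a::ring_1) oper \<Rightarrow> ('s \<times> 's, 'a) oper \<Rightarrow> ('s \<times> 's, 'a) oper" where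
  "conj_gg g X = leg1 g * leg2 g * X * op_inv (leg1 g) * op_inv (leg2 g)"

definition YBE_gg :: "('s, 'a::ring_1) oper \<Rightarrow> ('s \<times> 's, 'a) oper \<Rightarrow> bool" where
  "YBE_gg g R \<longleftrightarrow>
     leg12 R * leg13 (conj_gg g R) * leg23 R = leg23 (conj_gg g R) * leg13 R * leg12 (conj_gg g R)"

definition nondyn_solution ::
  "('n::finite \<times> 'm::spectral_exponent, complex) oper \<Rightarrow>
   (complex ^ 'n \<Rightarrow> (('n \<times> 'm) \<times> ('n \<times> 'm), complex) oper) \<Rightarrow>
   (complex ^ 'n \<Rightarrow> (('n \<times> 'm) \<times> ('n \<times> 'm), complex) oper) \<Rightarrow>
   (complex ^ 'n \<Rightarrow> ('n \<times> 'm, 'a::complex_algebra_1) oper) \<Rightarrow> bool" where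
  "nondyn_solution g R0 Rbar Q0 \<longleftrightarrow> dyn_matrix1 Q0 \<and> nondynamical Q0 \<and>
     (\<forall>lam. emb (R0 lam) * leg1 (Q0 lam) * emb (op_inv (leg2 g)) * leg2 (Q0 lam) * emb (leg2 g)
          = leg2 (Q0 lam) * emb (op_inv (leg1 g)) * leg1 (Q0 lam) * emb (leg1 g) * emb (Rbar lam))"

text \<open>That the coefficients and \<open>K\<close> are matrices is part of being a solution.\<close>

definition semidyn_solution ::
  "(complex ^ 'n::finite \<Rightarrow> (('n \<times> 'm::spectral_exponent) \<times> ('n \<times> 'm), complex) oper) \<Rightarrow>
   (complex ^ 'n \<Rightarrow> (('n \<times> 'm) \<times> ('n \<times> 'm), complex) oper) \<Rightarrow>
   (complex ^ 'n \<Rightarrow> (('n \<times> 'm) \<times> ('n \<times> 'm), complex) oper) \<Rightarrow>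
   (complex ^ 'n \<Rightarrow> (('n \<times> 'm) \<times> ('n \<times> 'm), complex) oper) \<Rightarrow>
   (complex ^ 'n \<Rightarrow> ('n \<times> 'm, 'a::complex_algebra_1) oper) \<Rightarrow> bool" where
  "semidyn_solution A B C D K \<longleftrightarrow>
     dyn_matrix2 A \<and> dyn_matrix2 B \<and> dyn_matrix2 C \<and> dyn_matrix2 D \<and> dyn_matrix1 K \<and>
     (\<forall>lam. emb (A lam) * leg1 (K lam) * emb (B lam) * shift_h1 (\<lambda>mu. leg2 (K mu)) lam
          = leg2 (K lam) * emb (C lam) * shift_h2 (\<lambda>mu. leg1 (K mu)) lam * emb (D lam))"


section \<open>The parametrization\<close>

definition G_op :: "('s, complex) oper \<Rightarrow> complex ^ 'n::finite \<Rightarrow> ('s \<times> 's, complex) oper" where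
  "G_op L lam = op_exp (op_scale (sigma lam) (leg1 L + leg2 L))"

definition A_mat ::
  "('n::finite \<times> 'm::spectral_exponent, complex) oper \<Rightarrow> ('n \<times> 'm, complex) oper \<Rightarrow>
   (complex ^ 'n \<Rightarrow> ('n \<times> 'm, complex) oper) \<Rightarrow>
   (complex ^ 'n \<Rightarrow> (('n \<times> 'm) \<times> ('n \<times> 'm), complex) oper) \<Rightarrow>
   complex ^ 'n \<Rightarrow> (('n \<times> 'm) \<times> ('n \<times> 'm), complex) oper" where
  "A_mat g L b R0 lam =
     op_inv (leg1 (b lam)) * op_inv (leg2 g * leg2 (b lam) * op_inv (leg2 g))
     * (op_inv (G_op L lam) * R0 lam * G_op L lam)
     * (leg1 g * leg1 (b lam) * op_inv (leg1 g)) * leg2 (b lam)"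

definition B_mat ::
  "('n::finite \<times> 'm::spectral_exponent, complex) oper \<Rightarrow>
   (complex ^ 'n \<Rightarrow> ('n \<times> 'm, complex) oper) \<Rightarrow>
   complex ^ 'n \<Rightarrow> (('n \<times> 'm) \<times> ('n \<times> 'm), complex) oper" where
  "B_mat g b lam =
     op_inv (leg2 (b lam)) * leg2 g * shift_h1 (\<lambda>mu. leg2 (b mu)) lam * op_inv (leg2 g)"

definition C_mat ::
  "('n::finite \<times> 'm::spectral_exponent, complex) oper \<Rightarrow>
   (complex ^ 'n \<Rightarrow> ('n \<times> 'm, complex) oper) \<Rightarrow>
   complex ^ 'n \<Rightarrow> (('n \<times> 'm) \<times> ('n \<times> 'm), complex) oper" where
  "C_mat g b lam =
     op_inv (leg1 (b lam)) * leg1 g * shift_h2 (\<lambda>mu. leg1 (b mu)) lam * op_inv (leg1 g)"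

definition D_mat ::
  "('n::finite \<times> 'm::spectral_exponent, complex) oper \<Rightarrow>
   (complex ^ 'n \<Rightarrow> ('n \<times> 'm, complex) oper) \<Rightarrow>
   (complex ^ 'n \<Rightarrow> (('n \<times> 'm) \<times> ('n \<times> 'm), complex) oper) \<Rightarrow>
   complex ^ 'n \<Rightarrow> (('n \<times> 'm) \<times> ('n \<times> 'm), complex) oper" where
  "D_mat L q Rbar lam =
     op_inv (shift_h2 (\<lambda>mu. leg1 (q mu)) lam) * op_inv (leg2 (q lam))
     * (op_inv (G_op L lam) * Rbar lam * G_op L lam)
     * leg1 (q lam) * shift_h1 (\<lambda>mu. leg2 (q mu)) lam"

definition K_mat ::
  "('n::finite \<times> 'm::spectral_exponent, complex) oper \<Rightarrow> ('n \<times> 'm, complex) oper \<Rightarrow>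
   (complex ^ 'n \<Rightarrow> ('n \<times> 'm, complex) oper) \<Rightarrow>
   (complex ^ 'n \<Rightarrow> ('n \<times> 'm, complex) oper) \<Rightarrow>
   (complex ^ 'n \<Rightarrow> ('n \<times> 'm, 'a::complex_algebra_1) oper) \<Rightarrow>
   complex ^ 'n \<Rightarrow> ('n \<times> 'm, 'a) oper" where
  "K_mat g L b q Q0 lam =
     emb (g * op_inv (b lam) * op_inv g)
     * (emb (op_exp (op_scale (- sigma lam) L)) * Q0 lam * emb (op_exp (op_scale (sigma lam) L)))
     * emb (q lam)"

end

(*
  Everything is a computation with three ingredients. Since e^{(s+t) log g} = e^{s log g} e^{t log g},
  the shift lambda -> lambda + epsilon_i, which raises sigma by 1, turns the dressed matrix
  Q = e^{-sigma log g} Q^0 e^{sigma log g} into g^{-1} Q g; hence the factors b(h) in B and C combine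
  with K(h) to g^{-1} Q g q(h), and the semi-dynamical equation reduces to the non-dynamical one
  conjugated by G = e^{sigma log g} (x) e^{sigma log g}.
  The matrices are exactly the operators commuting with all multiplications by u^d, and
  ad-factorizability forces e^{-s log g} u^d e^{s log g} to commute with every matrix, so it lies in
  the bicommutant C[[u]] of these multiplications. This is what carries ad-factorizability over to
  two spaces and to arbitrary coefficient algebras. The exponential law itself rests on the rows of
  all powers of log g being supported in a common finite set.
*)

theory Submission
  imports Defs "HOL-Complex_Analysis.Complex_Analysis"
begin

section \<open>Operators and tensor factors\<close>

text \<open>Operators are only required to have finite rows, so every infinite sum is treated entry
  by entry. For each \<open>s\<close> the rows of exp(s log g) are finite, but their supports could
  vary with \<open>s\<close>, while exchanging the exponential series with matrix products needs a
  finite set that serves all powers of log g at once. The entries are entire functions of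
  \<open>s\<close>, and the uncountability of the complex plane supplies this set.
  Ad-factorizability is assumed for complex coefficients in one space, and a general matrix in two
  spaces or over an algebra need not be a finite combination of such matrices, so linearity alone
  does not extend the property. The commutant description turns the question round: instead of the
  matrix, the monomials \<open>u_power d\<close> are conjugated, in the opposite direction, and
  these live in one space with complex coefficients. Their conjugates are power series rather than
  polynomials, which is harmless because each entry of a product sees only finitely many
  rows.\<close>

lemma op_inv_eqI:
  assumes "X * Y = 1" "Y * X = 1"
  shows "op_inv X = Y"
  unfolding op_inv_def
proof (rule the_equality)
  fix Z assume "X * Z = 1 \<and> Z * X = 1"
  then have "Z = Z * (X * Y)" and "Z * X * Y = Y"
    using assms by simp_all
  then show "Z = Y"
    by (simp add: mult.assoc)
qed (use assms in simp)

lemma entry_sum: "entry (\<Sum>i\<in>I. f i) x y = (\<Sum>i\<in>I. entry (f i) x y)"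
  by (induction I rule: infinite_finite_induct) (auto simp: zero_oper.rep_eq plus_oper.rep_eq)

lemma entry_leg1: "entry (leg1 X) (x1, x2) (y1, y2) = (if x2 = y2 then entry X x1 y1 else 0)"
  by (simp add: leg1.rep_eq)

lemma entry_leg2: "entry (leg2 X) (x1, x2) (y1, y2) = (if x1 = y1 then entry X x2 y2 else 0)"
  by (simp add: leg2.rep_eq)

text \<open>The row of \<open>leg1 X\<close> at \<open>(x1, x2)\<close> is the row of
  \<open>X\<close> at \<open>x1\<close> with \<open>x2\<close> carried along, so the sum over pairs
  collapses to a sum over one index.\<close>

lemma entry_leg1_times:
  "entry (leg1 X * Y) (x1, x2) z = (\<Sum>y | entry X x1 y \<noteq> 0. entry X x1 y * entry Y (y, x2) z)"
proof -
  let ?S = "{y. entry X x1 y \<noteq> 0}"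
  have "entry (leg1 X * Y) (x1, x2) z
      = (\<Sum>w \<in> (\<lambda>y. (y, x2)) ` ?S. entry (leg1 X) (x1, x2) w * entry Y w z)"
    by (rule entry_times) (auto simp: finite_row entry_leg1 split: if_splits)
  also have "\<dots> = (\<Sum>y\<in>?S. entry X x1 y * entry Y (y, x2) z)"
    by (subst sum.reindex) (auto simp: inj_on_def entry_leg1)
  finally show ?thesis .
qed

lemma entry_leg2_times:
  "entry (leg2 X * Y) (x1, x2) z = (\<Sum>y | entry X x2 y \<noteq> 0. entry X x2 y * entry Y (x1, y) z)"
proof -
  let ?S = "{y. entry X x2 y \<noteq> 0}"
  have "entry (leg2 X * Y) (x1, x2) z
      = (\<Sum>w \<in> (\<lambda>y. (x1, y)) ` ?S. entry (leg2 X) (x1, x2) w * entry Y w z)"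
    by (rule entry_times) (auto simp: finite_row entry_leg2 split: if_splits)
  also have "\<dots> = (\<Sum>y\<in>?S. entry X x2 y * entry Y (x1, y) z)"
    by (subst sum.reindex) (auto simp: inj_on_def entry_leg2)
  finally show ?thesis .
qed

lemma leg1_mult: "leg1 (X * Y) = leg1 X * leg1 (Y :: ('s, 'a::ring_1) oper)"
proof (rule oper_eqI)
  fix x z :: "'s \<times> 's"
  obtain x1 x2 z1 z2 where "x = (x1, x2)" "z = (z1, z2)" by fastforce
  then show "entry (leg1 (X * Y)) x z = entry (leg1 X * leg1 Y) x z"
    by (simp add: entry_leg1_times) (simp add: entry_leg1 times_oper.rep_eq)
qed

lemma leg2_mult: "leg2 (X * Y) = leg2 X * leg2 (Y :: ('s, 'a::ring_1) oper)"
proof (rule oper_eqI)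
  fix x z :: "'s \<times> 's"
  obtain x1 x2 z1 z2 where "x = (x1, x2)" "z = (z1, z2)" by fastforce
  then show "entry (leg2 (X * Y)) x z = entry (leg2 X * leg2 Y) x z"
    by (simp add: entry_leg2_times) (simp add: entry_leg2 times_oper.rep_eq)
qed

lemma leg1_one: "leg1 (1 :: ('s, 'a::ring_1) oper) = 1"
  by (rule oper_eqI) (auto simp: leg1.rep_eq one_oper.rep_eq split: prod.splits)

lemma leg2_one: "leg2 (1 :: ('s, 'a::ring_1) oper) = 1"
  by (rule oper_eqI) (auto simp: leg2.rep_eq one_oper.rep_eq split: prod.splits)

lemma leg1_zero: "leg1 (0 :: ('s, 'a::ring_1) oper) = 0"
  by (rule oper_eqI) (auto simp: leg1.rep_eq zero_oper.rep_eq split: prod.splits)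

lemma leg2_zero: "leg2 (0 :: ('s, 'a::ring_1) oper) = 0"
  by (rule oper_eqI) (auto simp: leg2.rep_eq zero_oper.rep_eq split: prod.splits)

lemma leg1_add: "leg1 (X + Y) = leg1 X + leg1 (Y :: ('s, 'a::ring_1) oper)"
  by (rule oper_eqI) (auto simp: leg1.rep_eq plus_oper.rep_eq split: prod.splits)

lemma leg2_add: "leg2 (X + Y) = leg2 X + leg2 (Y :: ('s, 'a::ring_1) oper)"
  by (rule oper_eqI) (auto simp: leg2.rep_eq plus_oper.rep_eq split: prod.splits)

lemma leg1_sum: "leg1 (\<Sum>i\<in>I. f i) = (\<Sum>i\<in>I. leg1 (f i :: ('s, 'a::ring_1) oper))"
  by (induction I rule: infinite_finite_induct) (auto simp: leg1_zero leg1_add)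

lemma leg2_sum: "leg2 (\<Sum>i\<in>I. f i) = (\<Sum>i\<in>I. leg2 (f i :: ('s, 'a::ring_1) oper))"
  by (induction I rule: infinite_finite_induct) (auto simp: leg2_zero leg2_add)

lemma leg1_power: "leg1 (X ^ k) = leg1 (X :: ('s, 'a::ring_1) oper) ^ k"
  by (induction k) (auto simp: leg1_one leg1_mult)

lemma leg2_power: "leg2 (X ^ k) = leg2 (X :: ('s, 'a::ring_1) oper) ^ k"
  by (induction k) (auto simp: leg2_one leg2_mult)

lemma entry_leg1_leg2:
  "entry (leg1 X * leg2 Y) (x1, x2) (z1, z2) = entry X x1 z1 * entry Y x2 z2"
proof -
  have "entry (leg1 X * leg2 Y) (x1, x2) (z1, z2)
      = (\<Sum>y | entry X x1 y \<noteq> 0. if y = z1 then entry X x1 y * entry Y x2 z2 else 0)"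
    unfolding entry_leg1_times by (intro sum.cong) (auto simp: entry_leg2)
  then show ?thesis by (simp add: finite_row)
qed

lemma entry_leg2_leg1:
  "entry (leg2 Y * leg1 X) (x1, x2) (z1, z2) = entry Y x2 z2 * entry X x1 z1"
proof -
  have "entry (leg2 Y * leg1 X) (x1, x2) (z1, z2)
      = (\<Sum>y | entry Y x2 y \<noteq> 0. if y = z2 then entry Y x2 y * entry X x1 z1 else 0)"
    unfolding entry_leg2_times by (intro sum.cong) (auto simp: entry_leg1)
  then show ?thesis by (simp add: finite_row)
qed

text \<open>The entries of the two products are products of one entry of each factor in opposite
  orders, so over a noncommutative algebra the legs commute as soon as the entries do.\<close>

lemma leg_commute:
  assumes "\<And>x1 z1 x2 z2. entry X x1 z1 * entry Y x2 z2 = entry Y x2 z2 * entry X x1 z1"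
  shows "leg2 Y * leg1 X = leg1 X * leg2 Y"
proof (rule oper_eqI)
  fix x z
  show "entry (leg2 Y * leg1 X) x z = entry (leg1 X * leg2 Y) x z"
    using assms by (cases x; cases z) (simp add: entry_leg1_leg2 entry_leg2_leg1)
qed

section \<open>Extension of scalars from the complex numbers to the coefficient algebra\<close>

lemma emb_mult: "emb (X * Y) = emb X * (emb Y :: ('s, 'a::complex_algebra_1) oper)"
proof (rule oper_eqI)
  fix x z
  let ?S = "{y. entry X x y \<noteq> 0}"
  have sum: "of_cplx (\<Sum>y\<in>S. f y) = (\<Sum>y\<in>S. of_cplx (f y) :: 'a)" for f :: "'s \<Rightarrow> complex" and S
    by (induction S rule: infinite_finite_induct) (auto simp: of_cplx_0 of_cplx_add)
  have "entry (emb X * emb Y :: ('s, 'a) oper) x z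
      = (\<Sum>y\<in>?S. entry (emb X) x y * entry (emb Y) y z)"
    by (rule entry_times) (auto simp: emb.rep_eq finite_row of_cplx_0)
  then show "entry (emb (X * Y)) x z = entry (emb X * emb Y :: ('s, 'a) oper) x z"
    by (simp add: emb.rep_eq times_oper.rep_eq[of X Y] sum of_cplx_mult)
qed

lemma emb_one: "emb 1 = (1 :: ('s, 'a::complex_algebra_1) oper)"
  by (rule oper_eqI) (auto simp: emb.rep_eq one_oper.rep_eq of_cplx_0 of_cplx_1)

lemma emb_zero: "emb 0 = (0 :: ('s, 'a::complex_algebra_1) oper)"
  by (rule oper_eqI) (auto simp: emb.rep_eq zero_oper.rep_eq of_cplx_0)

lemma emb_add: "emb (X + Y) = emb X + (emb Y :: ('s, 'a::complex_algebra_1) oper)"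
  by (rule oper_eqI) (auto simp: emb.rep_eq plus_oper.rep_eq of_cplx_add)

lemma emb_sum: "emb (\<Sum>i\<in>I. f i) = (\<Sum>i\<in>I. emb (f i) :: ('s, 'a::complex_algebra_1) oper)"
  by (induction I rule: infinite_finite_induct) (auto simp: emb_zero emb_add)

lemma emb_complex: "emb X = X"
  by (rule oper_eqI) (simp add: emb.rep_eq of_cplx_complex_def)

lemma emb_leg1: "emb (leg1 X) = (leg1 (emb X) :: ('s \<times> 's, 'a::complex_algebra_1) oper)"
  by (rule oper_eqI) (auto simp: emb.rep_eq leg1.rep_eq of_cplx_0 split: prod.splits)

lemma emb_leg2: "emb (leg2 X) = (leg2 (emb X) :: ('s \<times> 's, 'a::complex_algebra_1) oper)"
  by (rule oper_eqI) (auto simp: emb.rep_eq leg2.rep_eq of_cplx_0 split: prod.splits)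

text \<open>Two copies of \<open>K\<close> with entries in the algebra cannot be moved past each
  other, but a factor with complex entries passes, scalars being central.\<close>

lemma leg1_emb_commute: "leg2 Y * leg1 (emb X) = leg1 (emb X) * leg2 Y"
  by (rule leg_commute) (simp add: emb.rep_eq of_cplx_central)

lemma leg2_emb_commute: "leg2 (emb Y) * leg1 X = leg1 X * leg2 (emb Y)"
  by (rule leg_commute) (simp add: emb.rep_eq of_cplx_central)

lemma leg_complex_commute: "leg2 Y * leg1 X = leg1 X * leg2 (Y :: ('s, complex) oper)"
  by (rule leg_commute) simp


section \<open>The one-parameter group of a logarithm\<close>

lemma op_scale_one: "op_scale 1 X = X"
  by (rule oper_eqI) (simp add: op_scale.rep_eq)

lemma op_scale_mult: "op_scale c X * Y = op_scale c (X * Y)" "X * op_scale c Y = op_scale c (X * Y)"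
proof -
  show "op_scale c X * Y = op_scale c (X * Y)"
  proof (rule oper_eqI)
    fix x z
    have "entry (op_scale c X * Y) x z
        = (\<Sum>y | entry X x y \<noteq> 0. entry (op_scale c X) x y * entry Y y z)"
      by (rule entry_times) (auto simp: finite_row op_scale.rep_eq)
    then show "entry (op_scale c X * Y) x z = entry (op_scale c (X * Y)) x z"
      by (simp add: op_scale.rep_eq times_oper.rep_eq[of X Y] sum_distrib_left mult.assoc)
  qed
  show "X * op_scale c Y = op_scale c (X * Y)"
    by (rule oper_eqI)
      (simp add: op_scale.rep_eq times_oper.rep_eq sum_distrib_left mult.left_commute)
qed

lemma entry_op_scale_power: "entry (op_scale s L ^ k) x y = s ^ k * entry (L ^ k) x y"
proof -
  have "op_scale s L ^ k = op_scale (s ^ k) (L ^ k)"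
  proof (induction k)
    case 0
    show ?case by (simp add: op_scale_one)
  next
    case (Suc k)
    show ?case by (rule oper_eqI) (simp add: Suc op_scale_mult op_scale.rep_eq mult.assoc)
  qed
  then show ?thesis by (simp add: op_scale.rep_eq)
qed

text \<open>With \<open>L\<close> and the position fixed, an entry of the one-parameter group is the
  power series in \<open>s\<close> with these coefficients, which opens the way to complex
  analysis.\<close>

definition exp_coeff :: "('s, complex) oper \<Rightarrow> 's \<Rightarrow> 's \<Rightarrow> nat \<Rightarrow> complex" where
  "exp_coeff L x y k = entry (L ^ k) x y / fact k"

lemma entry_op_exp:
  assumes "\<And>x y. summable (\<lambda>k. exp_coeff L x y k * s ^ k)"
    and "\<And>x. finite {y. (\<Sum>k. exp_coeff L x y k * s ^ k) \<noteq> 0}"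
  shows "entry (op_exp (op_scale s L)) x y = (\<Sum>k. exp_coeff L x y k * s ^ k)"
proof -
  have "op_exp (op_scale s L) = Abs_oper (\<lambda>x y. \<Sum>k. exp_coeff L x y k * s ^ k)"
    by (simp add: op_exp_def entry_op_scale_power exp_coeff_def mult.commute)
  then show ?thesis
    using assms(2) by (simp add: Abs_oper_inverse)
qed

context
  fixes L :: "('s, complex) oper"
  assumes exponentiable: "\<And>s. exponentiable (op_scale s L)"
begin

lemma summable_exp_coeff: "summable (\<lambda>k. exp_coeff L x y k * s ^ k)"
  using exponentiable[of s]
  by (simp add: exponentiable_def entry_op_scale_power exp_coeff_def mult.commute)

lemma summable_norm_exp_coeff: "summable (\<lambda>k. norm (exp_coeff L x y k * s ^ k))"
proof (rule powser_insidea[OF summable_exp_coeff])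
  \<comment> \<open>The series converges at the larger radius \<open>norm s + 1\<close>, hence
    absolutely at \<open>s\<close>.\<close>
  show "norm s < norm (of_real (norm s + 1) :: complex)"
    by (simp del: of_real_add)
qed

lemma entry_exp: "entry (op_exp (op_scale s L)) x y = (\<Sum>k. exp_coeff L x y k * s ^ k)"
proof (rule entry_op_exp[OF summable_exp_coeff])
  show "finite {y. (\<Sum>k. exp_coeff L x y k * s ^ k) \<noteq> 0}" for x
    using exponentiable[of s]
    by (simp add: exponentiable_def entry_op_scale_power exp_coeff_def mult.commute)
qed

text \<open>The entry is an entire function of \<open>s\<close>. By the identity theorem uncountably
  many zeros would make it vanish identically, against its nonzero Taylor coefficient.\<close>

lemma countable_zeros_exp:
  assumes "entry (L ^ k) x y \<noteq> 0"
  shows "countable {s. entry (op_exp (op_scale s L)) x y = 0}"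
proof (rule ccontr)
  assume unc: "uncountable {s. entry (op_exp (op_scale s L)) x y = 0}"
  let ?f = "\<lambda>s. \<Sum>k. exp_coeff L x y k * s ^ k"
  have sums: "(\<lambda>k. exp_coeff L x y k * s ^ k) sums ?f s" for s
    using summable_exp_coeff by (rule summable_sums)
  have "?f field_differentiable at z" for z
    using termdiffs_strong_converges_everywhere[where c = "exp_coeff L x y" and x = z,
        OF summable_exp_coeff]
    by (auto simp: field_differentiable_def)
  then have "?f holomorphic_on UNIV"
    by (simp add: holomorphic_on_def field_differentiable_at_within)
  then have "?f = (\<lambda>s. 0)"
    using holomorphic_countable_equal_UNIV[of ?f "\<lambda>s. 0"] unc
    by (simp only: entry_exp holomorphic_on_const simp_thms)
  then have sums_0: "(\<lambda>k. exp_coeff L x y k * s ^ k) sums 0" for s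
    using sums[of s] by (simp only: fun_cong[OF \<open>?f = (\<lambda>s. 0)\<close>, of s])
  have "exp_coeff L x y k = 0"
  \<comment> \<open>\<open>powser_0_nonzero\<close> yields a punctured disc without zeros from a
    nonzero coefficient of positive index; the constant coefficient is therefore read off at
    0.\<close>
  proof (cases "k = 0")
    case True
    then show ?thesis
      using sums_0[of 0] by (simp add: sums_iff)
  next
    case False
    show ?thesis
    proof (rule ccontr)
      assume "exp_coeff L x y k \<noteq> 0"
      then obtain r where r: "0 < r" "\<And>z :: complex. z \<in> cball 0 r - {0} \<Longrightarrow> (0 :: complex) \<noteq> 0"
        using powser_0_nonzero[of 1 0 "exp_coeff L x y" "\<lambda>_. 0" k] sums_0 False
        by (metis diff_zero gr0I zero_less_one)
      show False
        using r(1) r(2)[of "of_real r"] by simp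
    qed
  qed
  then show False
    using assms by (simp add: exp_coeff_def)
qed

text \<open>
  The supports of the rows of all powers are jointly finite: otherwise, by countability of the zeros
  of entire functions, some \<open>e\<^bsup>s L\<^esup>\<close> would have a row with infinite support.
\<close>

lemma finite_row_powers: "finite {y. \<exists>k. entry (L ^ k) x y \<noteq> 0}"
proof (rule ccontr)
  assume "infinite {y. \<exists>k. entry (L ^ k) x y \<noteq> 0}"
  \<comment> \<open>A sequence of distinct indices is enough, and it keeps the union of zero sets
    countable even when \<open>'s\<close> is not.\<close>
  then obtain f :: "nat \<Rightarrow> 's" where f: "inj f" "range f \<subseteq> {y. \<exists>k. entry (L ^ k) x y \<noteq> 0}"
    using infinite_countable_subset by blast
  have "\<exists>n. entry (op_exp (op_scale s L)) x (f n) = 0" for s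
  proof (rule ccontr)
    assume "\<nexists>n. entry (op_exp (op_scale s L)) x (f n) = 0"
    then have "range f \<subseteq> {y. entry (op_exp (op_scale s L)) x y \<noteq> 0}" by auto
    then have "finite (range f)"
      using finite_row by (rule finite_subset)
    then show False
      using range_inj_infinite[OF f(1)] by contradiction
  qed
  then have "UNIV = (\<Union>n. {s. entry (op_exp (op_scale s L)) x (f n) = 0})" by auto
  moreover have "countable {s. entry (op_exp (op_scale s L)) x (f n) = 0}" for n
  proof -
    obtain k where "entry (L ^ k) x (f n) \<noteq> 0"
      using subsetD[OF f(2), of "f n"] by auto
    then show ?thesis
      by (rule countable_zeros_exp)
  qed
  then have "countable (\<Union>n. {s. entry (op_exp (op_scale s L)) x (f n) = 0})"
    by (intro countable_UN) simp_all
  ultimately show False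
    using uncountable_UNIV_complex by simp
qed

text \<open>For each intermediate index \<open>y\<close> the product of entries is a Cauchy product.
  Because \<open>?S\<close> is finite and serves all powers, the sum over \<open>y\<close> can be
  exchanged with the series, and the binomial theorem evaluates each coefficient.\<close>

lemma exp_add: "op_exp (op_scale (s + t) L) = op_exp (op_scale s L) * op_exp (op_scale t L)"
proof (rule oper_eqI)
  fix x z
  let ?S = "{y. \<exists>k. entry (L ^ k) x y \<noteq> 0}"
  have conv: "(\<Sum>y\<in>?S. exp_coeff L x y i * exp_coeff L y z j)
      = entry (L ^ (i + j)) x z / (fact i * fact j)" for i j
  proof -
    have "entry (L ^ (i + j)) x z = (\<Sum>y\<in>?S. entry (L ^ i) x y * entry (L ^ j) y z)"
      unfolding power_add by (rule entry_times[OF finite_row_powers]) blast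
    then show ?thesis
      by (simp add: exp_coeff_def sum_divide_distrib)
  qed
  have cauchy: "(\<lambda>k. \<Sum>i\<le>k. (exp_coeff L x y i * s ^ i) * (exp_coeff L y z (k - i) * t ^ (k - i)))
      sums (entry (op_exp (op_scale s L)) x y * entry (op_exp (op_scale t L)) y z)" for y
    unfolding entry_exp by (rule Cauchy_product_sums) (rule summable_norm_exp_coeff)+
  have coeff: "(\<Sum>y\<in>?S. \<Sum>i\<le>k. (exp_coeff L x y i * s ^ i) * (exp_coeff L y z (k - i) * t ^ (k - i)))
      = exp_coeff L x z k * (s + t) ^ k" for k
  proof -
    have "(\<Sum>y\<in>?S. \<Sum>i\<le>k. (exp_coeff L x y i * s ^ i) * (exp_coeff L y z (k - i) * t ^ (k - i)))
        = (\<Sum>i\<le>k. (\<Sum>y\<in>?S. exp_coeff L x y i * exp_coeff L y z (k - i)) * (s ^ i * t ^ (k - i)))"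
      by (subst sum.swap) (simp add: sum_distrib_left sum_distrib_right algebra_simps)
    also have "\<dots> = (\<Sum>i\<le>k. entry (L ^ k) x z / fact k * (of_nat (k choose i) * s ^ i * t ^ (k - i)))"
      by (intro sum.cong) (simp_all add: conv binomial_fact)
    also have "\<dots> = exp_coeff L x z k * (s + t) ^ k"
      by (simp add: binomial_ring exp_coeff_def sum_distrib_left)
    finally show ?thesis .
  qed
  have "(\<lambda>k. exp_coeff L x z k * (s + t) ^ k)
      sums (\<Sum>y\<in>?S. entry (op_exp (op_scale s L)) x y * entry (op_exp (op_scale t L)) y z)"
    using sums_sum[of ?S "\<lambda>y k. \<Sum>i\<le>k. (exp_coeff L x y i * s ^ i)
        * (exp_coeff L y z (k - i) * t ^ (k - i))", OF cauchy]
    by (simp only: coeff)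
  moreover have "entry (op_exp (op_scale s L) * op_exp (op_scale t L)) x z
      = (\<Sum>y\<in>?S. entry (op_exp (op_scale s L)) x y * entry (op_exp (op_scale t L)) y z)"
  proof (rule entry_times[OF finite_row_powers], rule subsetI)
    fix y assume "y \<in> {y. entry (op_exp (op_scale s L)) x y \<noteq> 0}"
    then have "(\<Sum>k. exp_coeff L x y k * s ^ k) \<noteq> 0"
      by (simp add: entry_exp)
    then have "\<exists>k. exp_coeff L x y k \<noteq> 0"
      by (rule contrapos_np) simp
    then show "y \<in> ?S"
      by (auto simp: exp_coeff_def)
  qed
  ultimately show "entry (op_exp (op_scale (s + t) L)) x z
      = entry (op_exp (op_scale s L) * op_exp (op_scale t L)) x z"
    by (simp add: entry_exp sums_iff)
qed

lemma exp_scale_zero: "op_exp (op_scale 0 L) = 1"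
proof (rule oper_eqI)
  fix x y
  show "entry (op_exp (op_scale 0 L)) x y = entry 1 x y"
    unfolding entry_exp powser_zero by (simp add: exp_coeff_def)
qed

lemma exp_minus:
  "op_exp (op_scale s L) * op_exp (op_scale (- s) L) = 1"
  "op_exp (op_scale (- s) L) * op_exp (op_scale s L) = 1"
  using exp_add[of s "- s"] exp_add[of "- s" s] exp_scale_zero by simp_all

end

section \<open>The exponential of a sum over two legs\<close>

lemma binomial_commuting:
  fixes X Y :: "'a::ring_1"
  assumes "Y * X = X * Y"
  shows "(X + Y) ^ n = (\<Sum>k\<le>n. of_nat (n choose k) * (X ^ k * Y ^ (n - k)))"
proof (induction n)
  case 0
  show ?case by simp
next
  case (Suc n)
  have comm: "Y * X ^ k = X ^ k * Y" for k
    using power_commuting_commutes[of X Y k] assms by simp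
  have nat: "Z * (of_nat m * W) = of_nat m * (Z * W)" for Z W :: 'a and m
    by (metis mult.assoc mult_of_nat_commute)
  have X: "X * (of_nat m * (X ^ k * Y ^ j)) = of_nat m * (X ^ Suc k * Y ^ j)" for m k j
    by (simp add: nat mult.assoc)
  have Y: "Y * (of_nat m * (X ^ k * Y ^ j)) = of_nat m * (X ^ k * Y ^ Suc j)" for m k j
    by (simp add: nat) (simp add: mult.assoc[symmetric] comm)
  \<comment> \<open>Pascal's rule: the index-shifted sum collects the terms with a new factor
    \<open>X\<close>, the other those with a new factor \<open>Y\<close>. The top term of the latter
    vanishes since \<open>n choose Suc n\<close> is 0.\<close>
  have "(\<Sum>k\<le>Suc n. of_nat (Suc n choose k) * (X ^ k * Y ^ (Suc n - k)))
      = (\<Sum>k\<le>n. of_nat (n choose k) * (X ^ Suc k * Y ^ (n - k)))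
        + (\<Sum>k\<le>Suc n. of_nat (n choose k) * (X ^ k * Y ^ (Suc n - k)))"
    by (simp only: sum.atMost_Suc_shift[of _ n])
      (simp add: distrib_right sum.distrib add_ac)
  also have "(\<Sum>k\<le>Suc n. of_nat (n choose k) * (X ^ k * Y ^ (Suc n - k)))
      = (\<Sum>k\<le>n. of_nat (n choose k) * (X ^ k * Y ^ Suc (n - k)))"
    by (simp add: Suc_diff_le binomial_eq_0)
  finally show ?case
    by (simp only: power_Suc[of "X + Y"] Suc.IH distrib_right sum_distrib_left X Y sum.distrib)
qed

text \<open>Convergence and row-finiteness for \<open>leg1 L + leg2 L\<close> are inherited: the
  series of each entry is the Cauchy product of two series for \<open>L\<close>, and the sums are
  the entries of a product of two operators.\<close>

lemma exp_leg_sum: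
  assumes "\<And>s. exponentiable (op_scale s L)"
  shows "op_exp (op_scale s (leg1 L + leg2 L))
    = leg1 (op_exp (op_scale s L)) * leg2 (op_exp (op_scale s L))"
proof -
  have power: "exp_coeff (leg1 L + leg2 L) (x1, x2) (y1, y2) k
      = (\<Sum>i\<le>k. exp_coeff L x1 y1 i * exp_coeff L x2 y2 (k - i))" for x1 x2 y1 y2 k
  proof -
    have nat: "of_nat n * (X :: ('s \<times> 's, complex) oper) = op_scale (of_nat n) X" for n X
      by (induction n)
        (auto simp: distrib_right op_scale.rep_eq zero_oper.rep_eq plus_oper.rep_eq intro!: oper_eqI)
    have "entry ((leg1 L + leg2 L) ^ k) (x1, x2) (y1, y2)
        = (\<Sum>i\<le>k. of_nat (k choose i) * (entry (L ^ i) x1 y1 * entry (L ^ (k - i)) x2 y2))"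
      unfolding binomial_commuting[OF leg_complex_commute] nat leg1_power[symmetric] leg2_power[symmetric]
      by (simp add: entry_sum op_scale.rep_eq entry_leg1_leg2)
    then show ?thesis
      by (simp add: exp_coeff_def sum_divide_distrib binomial_fact)
  qed
  have sums: "(\<lambda>k. exp_coeff (leg1 L + leg2 L) (x1, x2) (y1, y2) k * s ^ k)
      sums (entry (op_exp (op_scale s L)) x1 y1 * entry (op_exp (op_scale s L)) x2 y2)" for x1 x2 y1 y2
  proof -
    have "(\<lambda>k. \<Sum>i\<le>k. (exp_coeff L x1 y1 i * s ^ i) * (exp_coeff L x2 y2 (k - i) * s ^ (k - i)))
        sums (entry (op_exp (op_scale s L)) x1 y1 * entry (op_exp (op_scale s L)) x2 y2)"
      unfolding entry_exp[OF assms]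
      by (rule Cauchy_product_sums) (rule summable_norm_exp_coeff[OF assms])+
    moreover have "(\<Sum>i\<le>k. (exp_coeff L x1 y1 i * s ^ i) * (exp_coeff L x2 y2 (k - i) * s ^ (k - i)))
        = exp_coeff (leg1 L + leg2 L) (x1, x2) (y1, y2) k * s ^ k" for k
      unfolding power sum_distrib_right by (intro sum.cong) (auto simp: power_add[symmetric])
    ultimately show ?thesis by simp
  qed
  then have sums': "(\<lambda>k. exp_coeff (leg1 L + leg2 L) x y k * s ^ k)
      sums entry (leg1 (op_exp (op_scale s L)) * leg2 (op_exp (op_scale s L))) x y" for x y
    by (cases x; cases y) (simp add: entry_leg1_leg2)
  show ?thesis
  proof (rule oper_eqI)
    fix x y
    have "entry (op_exp (op_scale s (leg1 L + leg2 L))) x y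
        = (\<Sum>k. exp_coeff (leg1 L + leg2 L) x y k * s ^ k)"
      by (rule entry_op_exp) (use sums' finite_row in \<open>simp_all add: sums_iff\<close>)
    then show "entry (op_exp (op_scale s (leg1 L + leg2 L))) x y
        = entry (leg1 (op_exp (op_scale s L)) * leg2 (op_exp (op_scale s L))) x y"
      using sums'[of x y] by (simp add: sums_iff)
  qed
qed


section \<open>Matrices as commutants\<close>

text \<open>Multiplication by the \<open>d\<close>-th power of \<open>u\<close>; the operators
  commuting with all of these are the \<open>u\<close>-linear ones.\<close>

lift_definition u_power :: "'m \<Rightarrow> ('n::finite \<times> 'm::spectral_exponent, 'a::ring_1) oper"
  is "\<lambda>d x y. if fst x = fst y \<and> snd x = snd y + d then 1 else 0"
  subgoal for d x
    by (rule finite_subset[of _ "{fst x} \<times> {l. l \<le> snd x}"])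
      (auto simp: finite_below add_increasing2 split: if_splits)
  done

lemma entry_u_power: "entry (u_power d) (i, k) (j, l) = (if i = j \<and> k = l + d then 1 else 0)"
  by (simp add: u_power.rep_eq)

lemma eq_add_iff_diff: "k = l + d \<longleftrightarrow> d \<le> k \<and> l = k - d"
  for k l d :: "'m::spectral_exponent"
  by (auto simp: le_iff_add add.commute)

lemma emb_u_power: "emb (u_power d) = (u_power d :: ('n::finite \<times> 'm::spectral_exponent, 'a::complex_algebra_1) oper)"
  by (rule oper_eqI) (auto simp: emb.rep_eq u_power.rep_eq of_cplx_0 of_cplx_1)

text \<open>If \<open>w\<close> lies outside the row, the sum is empty of nonzero terms and
  \<open>entry X x w\<close> is 0 as well.\<close>

lemma sum_entry_delta:
  "(\<Sum>y | entry X x y \<noteq> 0. if y = w then entry X x y * c else 0) = entry X x w * (c :: 'a::ring_1)"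
  by (simp add: finite_row)

text \<open>Multiplication on the right shifts column exponents without loss, whereas on the left,
  in \<open>entry_u_power_times\<close>, it shifts row exponents and gives 0 where
  \<open>d \<le> k\<close> fails. Comparing the two characterizes matrices.\<close>

lemma entry_times_u_power: "entry (X * u_power d) x (j, l) = entry X x (j, l + d)"
proof -
  have "entry (X * u_power d) x (j, l)
      = (\<Sum>y | entry X x y \<noteq> 0. if y = (j, l + d) then entry X x y * 1 else 0)"
    unfolding times_oper.rep_eq by (intro sum.cong) (auto simp: entry_u_power split: if_splits)
  then show ?thesis unfolding sum_entry_delta by simp
qed

lemma entry_times_leg1_u_power:
  "entry (X * leg1 (u_power d)) x ((j, l), z) = entry X x ((j, l + d), z)"
proof -
  have "entry (X * leg1 (u_power d)) x ((j, l), z)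
      = (\<Sum>y | entry X x y \<noteq> 0. if y = ((j, l + d), z) then entry X x y * 1 else 0)"
    unfolding times_oper.rep_eq by (intro sum.cong) (auto simp: entry_leg1 entry_u_power split: if_splits)
  then show ?thesis unfolding sum_entry_delta by simp
qed

lemma entry_times_leg2_u_power:
  "entry (X * leg2 (u_power d)) x (z, (j, l)) = entry X x (z, (j, l + d))"
proof -
  have "entry (X * leg2 (u_power d)) x (z, (j, l))
      = (\<Sum>y | entry X x y \<noteq> 0. if y = (z, (j, l + d)) then entry X x y * 1 else 0)"
    unfolding times_oper.rep_eq by (intro sum.cong) (auto simp: entry_leg2 entry_u_power split: if_splits)
  then show ?thesis unfolding sum_entry_delta by simp
qed

lemma u_power_row:
  "{y. entry (u_power d :: ('n::finite \<times> 'm::spectral_exponent, 'a::ring_1) oper) (i, k) y \<noteq> 0}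
    = (if d \<le> k then {(i, k - d)} else {})"
  by (auto simp: entry_u_power eq_add_iff_diff split: if_splits)

lemma entry_u_power_times:
  "entry (u_power d * X) (i, k) z = (if d \<le> k then entry X (i, k - d) z else 0)"
  by (simp add: times_oper.rep_eq u_power_row) (simp add: entry_u_power ordered_cancel_comm_monoid_diff_class.diff_add)

lemma entry_leg1_u_power_times:
  "entry (leg1 (u_power d) * X) ((i, k), x) z = (if d \<le> k then entry X ((i, k - d), x) z else 0)"
  by (simp add: entry_leg1_times u_power_row) (simp add: entry_u_power ordered_cancel_comm_monoid_diff_class.diff_add)

lemma entry_leg2_u_power_times:
  "entry (leg2 (u_power d) * X) (x, (i, k)) z = (if d \<le> k then entry X (x, (i, k - d)) z else 0)"
  by (simp add: entry_leg2_times u_power_row) (simp add: entry_u_power ordered_cancel_comm_monoid_diff_class.diff_add)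

text \<open>A matrix coefficient depends on the exponents through their difference only, so adding
  \<open>d\<close> to the column has the effect of removing \<open>d\<close> from the row, support
  conditions included.\<close>

lemma le_diff_cases:
  "(if l + d \<le> k then f (k - (l + d)) else (0 :: 'a::zero))
    = (if d \<le> k then if l \<le> k - d then f (k - d - l) else 0 else 0)"
  for k l d :: "'m::spectral_exponent"
proof (cases "d \<le> k")
  case True
  then show ?thesis
    by (simp add: ordered_cancel_comm_monoid_diff_class.le_diff_conv2 diff_diff_eq add.commute)
next
  case False
  then have "\<not> l + d \<le> k"
    by (auto simp: le_iff_add add.assoc add.left_commute)
  then show ?thesis using False by simp
qed

text \<open>Commuting with \<open>u_power l\<close> moves the column exponent \<open>l\<close> to 0
  and the row exponent \<open>k\<close> to \<open>k - l\<close>; hence the columns with exponent 0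
  determine the operator and serve as its coefficients.\<close>

lemma one_space_matrix_iff_commute:
  "one_space_matrix X \<longleftrightarrow> (\<forall>d. X * u_power d = u_power d * X)"
proof
  assume "one_space_matrix X"
  then obtain c where c: "\<And>i k j l. entry X (i, k) (j, l) = (if l \<le> k then c i j (k - l) else 0)"
    unfolding one_space_matrix_def by blast
  show "\<forall>d. X * u_power d = u_power d * X"
  proof (rule allI, rule oper_eqI)
    fix d x z
    show "entry (X * u_power d) x z = entry (u_power d * X) x z"
      by (cases x; cases z) (simp add: entry_times_u_power entry_u_power_times c le_diff_cases)
  qed
next
  assume *: "\<forall>d. X * u_power d = u_power d * X"
  have "entry X (i, k) (j, l) = (if l \<le> k then entry X (i, k - l) (j, 0) else 0)" for i k j l
    using entry_times_u_power[of X l "(i, k)" j 0] by (simp add: * entry_u_power_times)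
  then show "one_space_matrix X"
    unfolding one_space_matrix_def by (intro exI[of _ "\<lambda>i j d. entry X (i, d) (j, 0)"]) blast
qed

lemma two_space_matrix_iff_commute:
  fixes X :: "(('n::finite \<times> 'm::spectral_exponent) \<times> ('n \<times> 'm), 'a::ring_1) oper"
  shows "two_space_matrix X \<longleftrightarrow>
    (\<forall>d. X * leg1 (u_power d) = leg1 (u_power d) * X \<and> X * leg2 (u_power d) = leg2 (u_power d) * X)"
proof
  assume "two_space_matrix X"
  \<comment> \<open>Nesting the two conditions lets \<open>le_diff_cases\<close> treat one leg at a
    time.\<close>
  then obtain c where c: "\<And>i1 k1 i2 k2 j1 l1 j2 l2. entry X ((i1, k1), (i2, k2)) ((j1, l1), (j2, l2)) =
      (if l1 \<le> k1 then if l2 \<le> k2 then c i1 i2 j1 j2 (k1 - l1) (k2 - l2) else 0 else 0)"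
    unfolding two_space_matrix_def by (auto simp: if_if_eq_conj)
  show "\<forall>d. X * leg1 (u_power d) = leg1 (u_power d) * X \<and> X * leg2 (u_power d) = leg2 (u_power d) * X"
  proof (intro allI conjI; rule oper_eqI)
    fix d and x z :: "('n \<times> 'm) \<times> ('n \<times> 'm)"
    obtain i1 k1 i2 k2 j1 l1 j2 l2
      where xz: "x = ((i1, k1), (i2, k2))" "z = ((j1, l1), (j2, l2))" by (metis surj_pair)
    show "entry (X * leg1 (u_power d)) x z = entry (leg1 (u_power d) * X) x z"
      unfolding xz entry_times_leg1_u_power entry_leg1_u_power_times c
      by (rule le_diff_cases)
    show "entry (X * leg2 (u_power d)) x z = entry (leg2 (u_power d) * X) x z"
      unfolding xz entry_times_leg2_u_power entry_leg2_u_power_times c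
      by (cases "l1 \<le> k1") (simp_all only: le_diff_cases if_True if_False if_cancel)
  qed
next
  assume *: "\<forall>d. X * leg1 (u_power d) = leg1 (u_power d) * X \<and> X * leg2 (u_power d) = leg2 (u_power d) * X"
  have "entry X ((i1, k1), (i2, k2)) ((j1, l1), (j2, l2)) =
      (if l1 \<le> k1 \<and> l2 \<le> k2 then entry X ((i1, k1 - l1), (i2, k2 - l2)) ((j1, 0), (j2, 0)) else 0)"
    for i1 k1 i2 k2 j1 l1 j2 l2
    using entry_times_leg1_u_power[of X l1 "((i1, k1), (i2, k2))" j1 0 "(j2, l2)"]
      entry_times_leg2_u_power[of X l2 "((i1, k1 - l1), (i2, k2))" "(j1, 0)" j2 0]
    by (auto simp: * entry_leg1_u_power_times entry_leg2_u_power_times split: if_splits)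
  then show "two_space_matrix X"
    unfolding two_space_matrix_def
    by (intro exI[of _ "\<lambda>i1 i2 j1 j2 d1 d2. entry X ((i1, d1), (i2, d2)) ((j1, 0), (j2, 0))"]) blast
qed

section \<open>Closure properties of matrices\<close>

lemma commute_mult:
  fixes X :: "'a::semigroup_mult"
  assumes "X * U = U * X" "Y * U = U * Y"
  shows "X * Y * U = U * (X * Y)"
  using assms by (metis mult.assoc)

lemma one_space_matrix_mult:
  "one_space_matrix X \<Longrightarrow> one_space_matrix Y \<Longrightarrow> one_space_matrix (X * Y)"
  for X :: "('n::finite \<times> 'm::spectral_exponent, 'a::ring_1) oper"
  by (simp add: one_space_matrix_iff_commute commute_mult)

lemma one_space_matrix_one:
  "one_space_matrix (1 :: ('n::finite \<times> 'm::spectral_exponent, 'a::ring_1) oper)"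
  by (simp add: one_space_matrix_iff_commute)

lemma one_space_matrix_emb:
  assumes "one_space_matrix X"
  shows "one_space_matrix
    (emb X :: ('n::finite \<times> 'm::spectral_exponent, 'a::complex_algebra_1) oper)"
  using assms emb_mult by (metis emb_u_power one_space_matrix_iff_commute)

lemma one_space_matrix_e_diag:
  "one_space_matrix (e_diag i :: ('n::finite \<times> 'm::spectral_exponent, 'a::ring_1) oper)"
  unfolding one_space_matrix_def
  by (rule exI[of _ "\<lambda>a b d. if a = b \<and> a = i \<and> d = 0 then 1 else 0"])
    (auto simp: e_diag.rep_eq dest: ordered_cancel_comm_monoid_diff_class.diff_add)

lemma two_space_matrix_mult:
  "two_space_matrix X \<Longrightarrow> two_space_matrix Y \<Longrightarrow> two_space_matrix (X * Y)"
  for X :: "(('n::finite \<times> 'm::spectral_exponent) \<times> ('n \<times> 'm), 'a::ring_1) oper"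
  by (simp add: two_space_matrix_iff_commute commute_mult)

lemma two_space_matrix_sum:
  fixes f :: "'i \<Rightarrow> (('n::finite \<times> 'm::spectral_exponent) \<times> ('n \<times> 'm), 'a::ring_1) oper"
  assumes "\<And>i. i \<in> I \<Longrightarrow> two_space_matrix (f i)"
  shows "two_space_matrix (\<Sum>i\<in>I. f i)"
  using assms by (simp add: two_space_matrix_iff_commute sum_distrib_left sum_distrib_right)

lemma two_space_matrix_leg1:
  fixes X :: "('n::finite \<times> 'm::spectral_exponent, complex) oper"
  assumes "one_space_matrix X"
  shows "two_space_matrix (leg1 X)"
  using assms
  by (simp add: two_space_matrix_iff_commute one_space_matrix_iff_commute leg_complex_commute
      leg1_mult[symmetric])

lemma two_space_matrix_leg2:
  fixes X :: "('n::finite \<times> 'm::spectral_exponent, complex) oper"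
  assumes "one_space_matrix X"
  shows "two_space_matrix (leg2 X)"
  using assms
  by (simp add: two_space_matrix_iff_commute one_space_matrix_iff_commute leg_complex_commute
      leg2_mult[symmetric])


section \<open>Conjugation by an ad-factorizable operator\<close>

text \<open>The entry of \<open>X * T\<close> at \<open>x\<close> uses the rows of \<open>T\<close>
  met by row \<open>x\<close> of \<open>X\<close>, that of \<open>T * X\<close> uses row
  \<open>x\<close> of \<open>T\<close>. Finitely many rows thus decide each entry, and approximation
  row by row takes the place of a continuity argument.\<close>

lemma commute_if_rows_approximable:
  fixes X T :: "('s, 'a::ring_1) oper"
  assumes "\<And>Y. finite Y \<Longrightarrow> \<exists>T'. X * T' = T' * X \<and> (\<forall>y\<in>Y. \<forall>z. entry T' y z = entry T y z)"
  shows "X * T = T * X"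
proof (rule oper_eqI)
  fix x z
  let ?S = "{y. entry X x y \<noteq> 0}"
  obtain T' where T': "X * T' = T' * X" "\<And>y z. y \<in> insert x ?S \<Longrightarrow> entry T' y z = entry T y z"
    using assms[of "insert x ?S"] finite_row[of X x] by (metis finite_insert)
  have "entry (X * T) x z = entry (X * T') x z"
    unfolding times_oper.rep_eq using T'(2) by (intro sum.cong) auto
  also have "\<dots> = entry (T * X) x z"
    unfolding T'(1) times_oper.rep_eq using T'(2)[of x] by simp
  finally show "entry (X * T) x z = entry (T * X) x z" .
qed

text \<open>The matrix units with constant coefficients; commuting with them forces a matrix to be
  scalar on \<open>V\<close>.\<close>

lift_definition matrix_unit :: "'n \<Rightarrow> 'n \<Rightarrow> ('n::finite \<times> 'm::spectral_exponent, 'a::ring_1) oper"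
  is "\<lambda>i j x y. if fst x = i \<and> y = (j, snd x) then 1 else 0"
  subgoal for i j x
    by (rule finite_subset[of _ "{(j, snd x)}"]) auto
  done

lemma one_space_matrix_matrix_unit:
  "one_space_matrix (matrix_unit i j :: ('n::finite \<times> 'm::spectral_exponent, 'a::ring_1) oper)"
  unfolding one_space_matrix_def
  by (rule exI[of _ "\<lambda>a b d. if a = i \<and> b = j \<and> d = 0 then 1 else 0"])
    (auto simp: matrix_unit.rep_eq dest: ordered_cancel_comm_monoid_diff_class.diff_add)

lemma entry_times_matrix_unit:
  "entry (X * matrix_unit i j) x (b, l) = (if b = j then entry X x (i, l) else 0)"
proof -
  have "entry (X * matrix_unit i j) x (b, l)
      = (\<Sum>y | entry X x y \<noteq> 0. if y = (i, l) then entry X x y * (if b = j then 1 else 0) else 0)"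
    unfolding times_oper.rep_eq by (intro sum.cong) (auto simp: matrix_unit.rep_eq split: if_splits)
  then show ?thesis unfolding sum_entry_delta by simp
qed

lemma entry_matrix_unit_times:
  fixes X :: "('n::finite \<times> 'm::spectral_exponent, 'a::ring_1) oper"
  shows "entry (matrix_unit i j * X) (a, k) z = (if a = i then entry X (j, k) z else 0)"
proof -
  have "{y. entry (matrix_unit i j :: ('n \<times> 'm, 'a) oper) (a, k) y \<noteq> 0} = (if a = i then {(j, k)} else {})"
    by (auto simp: matrix_unit.rep_eq)
  then show ?thesis
    by (simp add: times_oper.rep_eq) (simp add: matrix_unit.rep_eq)
qed

text \<open>The bicommutant of the multiplications by powers of \<open>u\<close> is \<open>\<complex>[[u]]\<close>.\<close>

lemma bicommutant_rows:
  fixes T :: "('n::finite \<times> 'm::spectral_exponent, complex) oper"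
  assumes T: "\<And>X. one_space_matrix X \<Longrightarrow> X * T = T * X" and "finite Y"
  shows "\<exists>D p. finite D \<and>
    (\<forall>x\<in>Y. \<forall>z. entry (\<Sum>d\<in>D. op_scale (p d) (u_power d)) x z = entry T x z)"
proof -
  have "one_space_matrix (u_power d :: ('n \<times> 'm, complex) oper)" for d
    unfolding one_space_matrix_iff_commute
    by (rule allI, rule oper_eqI)
      (auto simp: entry_times_u_power entry_u_power add_ac)
  then have "one_space_matrix T"
    unfolding one_space_matrix_iff_commute[of T] using T by metis
  then obtain c where c: "\<And>i k j l. entry T (i, k) (j, l) = (if l \<le> k then c i j (k - l) else 0)"
    unfolding one_space_matrix_def by blast
  \<comment> \<open>Comparison of \<open>T\<close> times a matrix unit with the reverse product:
    entries off the diagonal of \<open>V\<close> vanish and the diagonal ones agree.\<close>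
  have unit: "(if b = j then entry T (a, k) (i, l) else 0) = (if a = i then entry T (j, k) (b, l) else 0)"
    for a k i l j b
    using entry_times_matrix_unit[of T i j "(a, k)" b l]
    by (simp add: entry_matrix_unit_times flip: T[OF one_space_matrix_matrix_unit])
  \<comment> \<open>\<open>undefined\<close> is an arbitrary basis index of \<open>V\<close>: all
    diagonal entries agree. Column exponent 0 reads off the coefficient of degree
    \<open>d\<close>.\<close>
  define p where "p = (\<lambda>d. entry T (undefined, d) (undefined, 0))"
  have p: "entry T (i, k) (j, l) = (if i = j \<and> l \<le> k then p (k - l) else 0)" for i k j l
    using unit[of undefined undefined i k j l] unit[of undefined undefined i "k - l" i 0] c
    by (auto simp: p_def)
  \<comment> \<open>Row \<open>(i, k)\<close> involves only degrees up to \<open>k\<close>, so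
    truncating the power series to these finitely many degrees is exact on the rows in
    \<open>Y\<close>.\<close>
  let ?D = "\<Union>x\<in>Y. {d. d \<le> snd x}"
  have "entry (\<Sum>d\<in>?D. op_scale (p d) (u_power d)) (i, k) (j, l) = entry T (i, k) (j, l)"
    if "(i, k) \<in> Y" for i k j l
  proof -
    have fin: "finite ?D"
      using \<open>finite Y\<close> finite_below by blast
    have "entry (\<Sum>d\<in>?D. op_scale (p d) (u_power d)) (i, k) (j, l)
        = (\<Sum>d\<in>?D. if d = k - l then (if i = j \<and> l \<le> k then p d else 0) else 0)"
      unfolding entry_sum
      by (intro sum.cong)
        (auto simp: op_scale.rep_eq entry_u_power eq_add_iff_diff[of k d l for d] add.commute)
    moreover have "k - l \<in> ?D" if "l \<le> k"
    proof -
      have "k - l \<le> k"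
        using ordered_cancel_comm_monoid_diff_class.diff_add[OF that] by (metis le_iff_add)
      then show ?thesis
        using UN_I[OF \<open>(i, k) \<in> Y\<close>, of "k - l" "\<lambda>x. {d. d \<le> snd x}"] by simp
    qed
    ultimately show ?thesis
      using fin by (simp add: p)
  qed
  then show ?thesis
    using \<open>finite Y\<close> finite_below by (intro exI[of _ ?D] exI[of _ p]) auto
qed

text \<open>One argument for \<open>emb\<close>, \<open>leg1\<close> and \<open>leg2\<close>, each
  in the role of \<open>\<phi>\<close>. Since row \<open>y\<close> of \<open>\<phi> A\<close>
  depends only on row \<open>r y\<close> of \<open>A\<close>, the polynomials in \<open>u\<close>
  that approximate \<open>T\<close> by rows are carried to approximations of
  \<open>\<phi> T\<close>.\<close>

lemma commute_bicommutant:
  fixes T :: "('n::finite \<times> 'm::spectral_exponent, complex) oper"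
    and \<phi> :: "('n \<times> 'm, complex) oper \<Rightarrow> ('t, 'a::ring_1) oper"
  assumes T: "\<And>Z. one_space_matrix Z \<Longrightarrow> Z * T = T * Z"
    and zero: "\<phi> 0 = 0" and add: "\<And>A B. \<phi> (A + B) = \<phi> A + \<phi> B"
    and mult: "\<And>A B. \<phi> (A * B) = \<phi> A * \<phi> B"
    and scalar: "\<And>c. X * \<phi> (op_scale c 1) = \<phi> (op_scale c 1) * X"
    and rows: "\<And>A B y. (\<And>z. entry A (r y) z = entry B (r y) z) \<Longrightarrow>
      (\<And>z. entry (\<phi> A) y z = entry (\<phi> B) y z)"
    and u_power: "\<And>d. X * \<phi> (u_power d) = \<phi> (u_power d) * X"
  shows "X * \<phi> T = \<phi> T * X"
proof (rule commute_if_rows_approximable)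
  fix Y :: "'t set"
  assume "finite Y"
  obtain D p where D: "finite D"
      "\<forall>x\<in>r ` Y. \<forall>z. entry (\<Sum>d\<in>D. op_scale (p d) (u_power d)) x z = entry T x z"
    using bicommutant_rows[OF T, of "r ` Y"] \<open>finite Y\<close> by blast
  have "X * \<phi> (\<Sum>d\<in>D. op_scale (p d) (u_power d)) = \<phi> (\<Sum>d\<in>D. op_scale (p d) (u_power d)) * X"
    using D(1)
  proof induction
    case (insert d D)
    \<comment> \<open>Scaling is multiplication by \<open>op_scale c 1\<close>, so
      \<open>scalar\<close> and \<open>mult\<close> do the work of complex linearity of
      \<open>\<phi>\<close>.\<close>
    have "X * \<phi> (op_scale (p d) (u_power d)) = \<phi> (op_scale (p d) (u_power d)) * X"
      using commute_mult[OF scalar[symmetric] u_power[symmetric]]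
      by (simp add: op_scale_mult flip: mult)
    then show ?case
      using insert by (simp add: add distrib_left distrib_right)
  qed (simp add: zero)
  moreover have "entry (\<phi> (\<Sum>d\<in>D. op_scale (p d) (u_power d))) y z = entry (\<phi> T) y z" if "y \<in> Y" for y z
    using that D(2) by (intro rows) auto
  ultimately show "\<exists>T'. X * T' = T' * X \<and> (\<forall>y\<in>Y. \<forall>z. entry T' y z = entry (\<phi> T) y z)"
    by blast
qed

lemma emb_scalar_central: "X * emb (op_scale c 1) = emb (op_scale c 1) * X"
proof (rule oper_eqI)
  fix x z
  have "entry (X * emb (op_scale c 1)) x z
      = (\<Sum>y | entry X x y \<noteq> 0. if y = z then entry X x y * of_cplx c else 0)"
    unfolding times_oper.rep_eq
    by (intro sum.cong) (auto simp: emb.rep_eq op_scale.rep_eq one_oper.rep_eq of_cplx_0)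
  also have "\<dots> = of_cplx c * entry X x z"
    unfolding sum_entry_delta by (rule of_cplx_central[symmetric])
  also have "\<dots> = entry (emb (op_scale c 1) * X) x z"
    by (subst entry_times[of "{x}"])
      (auto simp: emb.rep_eq op_scale.rep_eq one_oper.rep_eq of_cplx_0)
  finally show "entry (X * emb (op_scale c 1)) x z = entry (emb (op_scale c 1) * X) x z" .
qed

context
  fixes e e' :: "('n::finite \<times> 'm::spectral_exponent, complex) oper"
  assumes inverse: "e * e' = 1" "e' * e = 1"
    and ad: "\<And>X. one_space_matrix X \<Longrightarrow> one_space_matrix (e * X * e')"
begin

lemma conj_u_power_bicommutant:
  assumes "one_space_matrix X"
  shows "X * (e' * u_power d * e) = e' * u_power d * e * X"
proof -
  have "X * (e' * u_power d * e) = e' * ((e * X * e') * u_power d) * e"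
    by (simp add: mult.assoc) (simp add: mult.assoc[symmetric] inverse)
  also have "(e * X * e') * u_power d = u_power d * (e * X * e')"
    using ad[OF assms] by (simp add: one_space_matrix_iff_commute)
  also have "e' * (u_power d * (e * X * e')) * e = e' * u_power d * e * X * (e' * e)"
    by (simp only: mult.assoc)
  finally show ?thesis
    by (simp add: inverse)
qed

text \<open>Stated for a bare monoid, so that it serves one space over any algebra and both legs of
  two spaces.\<close>

lemma conj_commute:
  fixes X f f' U :: "'b::monoid_mult"
  assumes "f * f' = 1" "f' * f = 1" "X * (f' * U * f) = f' * U * f * X"
  shows "f * X * f' * U = U * (f * X * f')"
proof -
  have "f * X * f' * U = f * X * f' * U * (f * f')"
    by (simp only: assms(1) mult_1_right)
  also have "\<dots> = f * (X * (f' * U * f)) * f'"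
    by (simp only: mult.assoc)
  also have "\<dots> = (f * f') * U * (f * X * f')"
    by (subst assms(3)) (simp only: mult.assoc)
  finally show ?thesis
    by (simp add: assms)
qed

text \<open>The conjugated monomials have complex entries, and \<open>X\<close> has to commute only
  with their images under \<open>emb\<close>; that follows from its commuting with
  \<open>u_power d\<close> and with scalars.\<close>

lemma one_space_matrix_conj:
  fixes X :: "('n \<times> 'm, 'a::complex_algebra_1) oper"
  assumes "one_space_matrix X"
  shows "one_space_matrix (emb e * X * emb e')"
proof -
  have "X * emb (e' * u_power d * e) = emb (e' * u_power d * e) * X" for d
  proof (rule commute_bicommutant[where \<phi> = emb and r = id])
    show "X * emb (u_power d) = emb (u_power d) * X" for d
      using assms by (simp add: one_space_matrix_iff_commute emb_u_power)
  qed (simp_all add: conj_u_power_bicommutant emb_zero emb_add emb_mult emb_scalar_central emb.rep_eq)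
  then have "X * (emb e' * u_power d * emb e) = emb e' * u_power d * emb e * X" for d
    by (simp add: emb_mult emb_u_power)
  then show ?thesis
    unfolding one_space_matrix_iff_commute
    by (intro allI conj_commute) (simp_all add: emb_mult[symmetric] inverse emb_one)
qed

lemma two_space_matrix_conj1:
  assumes "two_space_matrix X"
  shows "two_space_matrix (leg1 e * X * leg1 e')"
proof -
  have X1: "X * leg1 (e' * u_power d * e) = leg1 (e' * u_power d * e) * X" for d
  proof (rule commute_bicommutant[where \<phi> = leg1 and r = fst])
    show "X * leg1 (u_power d) = leg1 (u_power d) * X" for d
      using assms by (simp add: two_space_matrix_iff_commute)
    show "X * leg1 (op_scale c 1) = leg1 (op_scale c 1) * X" for c
    proof -
      have "leg1 (op_scale c 1) = op_scale c (1 :: (('n \<times> 'm) \<times> ('n \<times> 'm), complex) oper)"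
        by (rule oper_eqI) (auto simp: leg1.rep_eq op_scale.rep_eq one_oper.rep_eq split: prod.splits)
      then show ?thesis
        by (simp add: op_scale_mult)
    qed
    show "entry (leg1 A) y z = entry (leg1 B) y z"
      if "\<And>z. entry A (fst y) z = entry B (fst y) z" for A B :: "('n \<times> 'm, complex) oper" and y z
      using that by (cases y; cases z) (simp add: entry_leg1)
  qed (simp_all add: conj_u_power_bicommutant leg1_zero leg1_add leg1_mult)
  \<comment> \<open>Monomials of the other leg are unchanged by a conjugation in leg 1.\<close>
  have "X * (leg1 e' * leg2 (u_power d) * leg1 e) = leg1 e' * leg2 (u_power d) * leg1 e * X" for d
  proof -
    have "leg1 e' * leg2 (u_power d) * leg1 e = leg2 (u_power d)"
      by (simp add: mult.assoc leg_complex_commute)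
        (simp add: mult.assoc[symmetric] leg1_mult[symmetric] inverse leg1_one)
    then show ?thesis
      using assms by (simp add: two_space_matrix_iff_commute)
  qed
  then show ?thesis
    unfolding two_space_matrix_iff_commute using X1
    by (intro allI conjI conj_commute) (simp_all add: leg1_mult[symmetric] inverse leg1_one)
qed

lemma two_space_matrix_conj2:
  assumes "two_space_matrix X"
  shows "two_space_matrix (leg2 e * X * leg2 e')"
proof -
  have X2: "X * leg2 (e' * u_power d * e) = leg2 (e' * u_power d * e) * X" for d
  proof (rule commute_bicommutant[where \<phi> = leg2 and r = snd])
    show "X * leg2 (u_power d) = leg2 (u_power d) * X" for d
      using assms by (simp add: two_space_matrix_iff_commute)
    show "X * leg2 (op_scale c 1) = leg2 (op_scale c 1) * X" for c
    proof -
      have "leg2 (op_scale c 1) = op_scale c (1 :: (('n \<times> 'm) \<times> ('n \<times> 'm), complex) oper)"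
        by (rule oper_eqI) (auto simp: leg2.rep_eq op_scale.rep_eq one_oper.rep_eq split: prod.splits)
      then show ?thesis
        by (simp add: op_scale_mult)
    qed
    show "entry (leg2 A) y z = entry (leg2 B) y z"
      if "\<And>z. entry A (snd y) z = entry B (snd y) z" for A B :: "('n \<times> 'm, complex) oper" and y z
      using that by (cases y; cases z) (simp add: entry_leg2)
  qed (simp_all add: conj_u_power_bicommutant leg2_zero leg2_add leg2_mult)
  have "X * (leg2 e' * leg1 (u_power d) * leg2 e) = leg2 e' * leg1 (u_power d) * leg2 e * X" for d
  proof -
    have "leg2 e' * leg1 (u_power d) * leg2 e = leg1 (u_power d)"
      by (simp add: leg_complex_commute)
        (simp add: mult.assoc leg2_mult[symmetric] inverse leg2_one)
    then show ?thesis
      using assms by (simp add: two_space_matrix_iff_commute)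
  qed
  then show ?thesis
    unfolding two_space_matrix_iff_commute using X2
    by (intro allI conjI conj_commute) (simp_all add: leg2_mult[symmetric] inverse leg2_one)
qed

end

section \<open>Dynamical shifts\<close>

lemma emb_e_diag:
  "emb (e_diag i) = (e_diag i :: ('n::finite \<times> 'm::spectral_exponent, 'a::complex_algebra_1) oper)"
  by (rule oper_eqI) (auto simp: emb.rep_eq e_diag.rep_eq of_cplx_0 of_cplx_1)

lemma e_diag_mult:
  "e_diag i * e_diag j = (if i = j then e_diag i else 0 :: ('n::finite \<times> 'm::spectral_exponent, 'a::ring_1) oper)"
proof (rule oper_eqI)
  fix x z
  have "entry (e_diag i * e_diag j :: ('n \<times> 'm, 'a) oper) x z
      = (\<Sum>y\<in>{x}. entry (e_diag i) x y * entry (e_diag j) y z)"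
    by (rule entry_times) (auto simp: e_diag.rep_eq)
  then show "entry (e_diag i * e_diag j :: ('n \<times> 'm, 'a) oper) x z = entry (if i = j then e_diag i else 0) x z"
    by (auto simp: e_diag.rep_eq zero_oper.rep_eq)
qed

lemma sum_e_diag: "(\<Sum>i\<in>UNIV. e_diag i) = (1 :: ('n::finite \<times> 'm::spectral_exponent, 'a::ring_1) oper)"
  by (rule oper_eqI) (auto simp: entry_sum e_diag.rep_eq one_oper.rep_eq)

text \<open>The \<open>e_diag i\<close> are orthogonal projections acting in the other space, so
  cross terms vanish and products of shifted matrices are formed argument by argument.\<close>

lemma shift_h1_leg2_mult:
  fixes f h :: "complex ^ 'n::finite \<Rightarrow> ('n \<times> 'm::spectral_exponent, 'a::complex_algebra_1) oper"
  shows "shift_h1 (\<lambda>mu. leg2 (f mu)) lam * shift_h1 (\<lambda>mu. leg2 (h mu)) lam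
      = shift_h1 (\<lambda>mu. leg2 (f mu * h mu)) lam" (is ?mult)
    and "leg2 X * shift_h1 (\<lambda>mu. leg2 (f mu)) lam = shift_h1 (\<lambda>mu. leg2 (X * f mu)) lam" (is ?left)
    and "shift_h1 (\<lambda>mu. leg2 (f mu)) lam * leg2 X = shift_h1 (\<lambda>mu. leg2 (f mu * X)) lam" (is ?right)
proof -
  have comm: "leg1 (e_diag i) * leg2 Y = leg2 Y * leg1 (e_diag i)"
    for i and Y :: "('n \<times> 'm, 'a) oper"
    using leg1_emb_commute[of Y "e_diag i"] by (simp add: emb_e_diag)
  have "leg2 Y * leg1 (e_diag i) * (leg2 Z * leg1 (e_diag j))
      = (if i = j then leg2 (Y * Z) * leg1 (e_diag i) else 0)"
    for i j and Y Z :: "('n \<times> 'm, 'a) oper"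
  proof -
    have "leg2 Y * leg1 (e_diag i) * (leg2 Z * leg1 (e_diag j))
        = leg2 Y * (leg1 (e_diag i) * leg2 Z) * leg1 (e_diag j)"
      by (simp only: mult.assoc)
    also have "\<dots> = leg2 (Y * Z) * leg1 (e_diag i * e_diag j)"
      by (simp only: comm leg1_mult leg2_mult mult.assoc)
    finally show ?thesis
      by (simp add: e_diag_mult leg1_zero)
  qed
  then show ?mult
    by (simp add: shift_h1_def sum_product)
  show ?left
    by (simp add: shift_h1_def sum_distrib_left leg2_mult mult.assoc)
  show ?right
    by (simp add: shift_h1_def sum_distrib_right leg2_mult mult.assoc comm)
qed

lemma shift_h2_leg1_mult:
  fixes f h :: "complex ^ 'n::finite \<Rightarrow> ('n \<times> 'm::spectral_exponent, 'a::complex_algebra_1) oper"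
  shows "shift_h2 (\<lambda>mu. leg1 (f mu)) lam * shift_h2 (\<lambda>mu. leg1 (h mu)) lam
      = shift_h2 (\<lambda>mu. leg1 (f mu * h mu)) lam" (is ?mult)
    and "leg1 X * shift_h2 (\<lambda>mu. leg1 (f mu)) lam = shift_h2 (\<lambda>mu. leg1 (X * f mu)) lam" (is ?left)
    and "shift_h2 (\<lambda>mu. leg1 (f mu)) lam * leg1 X = shift_h2 (\<lambda>mu. leg1 (f mu * X)) lam" (is ?right)
proof -
  have comm: "leg2 (e_diag i) * leg1 Y = leg1 Y * leg2 (e_diag i)"
    for i and Y :: "('n \<times> 'm, 'a) oper"
    using leg2_emb_commute[of "e_diag i" Y] by (simp add: emb_e_diag)
  have "leg1 Y * leg2 (e_diag i) * (leg1 Z * leg2 (e_diag j))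
      = (if i = j then leg1 (Y * Z) * leg2 (e_diag i) else 0)"
    for i j and Y Z :: "('n \<times> 'm, 'a) oper"
  proof -
    have "leg1 Y * leg2 (e_diag i) * (leg1 Z * leg2 (e_diag j))
        = leg1 Y * (leg2 (e_diag i) * leg1 Z) * leg2 (e_diag j)"
      by (simp only: mult.assoc)
    also have "\<dots> = leg1 (Y * Z) * leg2 (e_diag i * e_diag j)"
      by (simp only: comm leg1_mult leg2_mult mult.assoc)
    finally show ?thesis
      by (simp add: e_diag_mult leg2_zero)
  qed
  then show ?mult
    by (simp add: shift_h2_def sum_product)
  show ?left
    by (simp add: shift_h2_def sum_distrib_left leg1_mult mult.assoc)
  show ?right
    by (simp add: shift_h2_def sum_distrib_right leg1_mult mult.assoc comm)
qed

text \<open>Completeness of the projections; with multiplicativity it lets \<open>q_1(h_2)\<close>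
  be inverted argument by argument.\<close>

lemma shift_h2_one: "shift_h2 (\<lambda>_. 1) lam = 1"
  by (simp add: shift_h2_def leg2_sum[symmetric] sum_e_diag leg2_one)

lemma emb_shift_h1:
  "emb (shift_h1 (\<lambda>mu. leg2 (f mu)) lam) = shift_h1 (\<lambda>mu. leg2 (emb (f mu))) lam"
  by (simp add: shift_h1_def emb_sum emb_mult emb_leg1 emb_leg2 emb_e_diag)

lemma emb_shift_h2:
  "emb (shift_h2 (\<lambda>mu. leg1 (f mu)) lam) = shift_h2 (\<lambda>mu. leg1 (emb (f mu))) lam"
  by (simp add: shift_h2_def emb_sum emb_mult emb_leg1 emb_leg2 emb_e_diag)

lemma two_space_matrix_shift_h1:
  fixes f :: "complex ^ 'n::finite \<Rightarrow> ('n \<times> 'm::spectral_exponent, complex) oper"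
  assumes "\<And>mu. one_space_matrix (f mu)"
  shows "two_space_matrix (shift_h1 (\<lambda>mu. leg2 (f mu)) lam)"
  unfolding shift_h1_def
  by (intro two_space_matrix_sum two_space_matrix_mult two_space_matrix_leg1 two_space_matrix_leg2
      one_space_matrix_e_diag assms)

lemma two_space_matrix_shift_h2:
  fixes f :: "complex ^ 'n::finite \<Rightarrow> ('n \<times> 'm::spectral_exponent, complex) oper"
  assumes "\<And>mu. one_space_matrix (f mu)"
  shows "two_space_matrix (shift_h2 (\<lambda>mu. leg1 (f mu)) lam)"
  unfolding shift_h2_def
  by (intro two_space_matrix_sum two_space_matrix_mult two_space_matrix_leg1 two_space_matrix_leg2
      one_space_matrix_e_diag assms)

lemma op_inv_leg1:
  assumes "X * Y = 1" "Y * X = (1 :: ('s, 'a::ring_1) oper)"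
  shows "op_inv (leg1 X) = leg1 Y"
  by (rule op_inv_eqI) (simp_all add: assms leg1_mult[symmetric] leg1_one)

lemma op_inv_leg2:
  assumes "X * Y = 1" "Y * X = (1 :: ('s, 'a::ring_1) oper)"
  shows "op_inv (leg2 X) = leg2 Y"
  by (rule op_inv_eqI) (simp_all add: assms leg2_mult[symmetric] leg2_one)

lemma sigma_shift: "sigma (lam + axis i 1) = sigma lam + 1"
  by (simp add: sigma_def sum.distrib axis_def)

text \<open>In this rule and the next three, the factor that changes places with the other leg is
  the one marked by \<open>emb\<close>; two legs with entries in the algebra are never
  exchanged.\<close>

lemma leg1_leg2_times_emb:
  "leg1 A * leg2 (emb B) * (leg1 C * leg2 D) = leg1 (A * C) * leg2 (emb B * D)"
proof -
  have "leg1 A * leg2 (emb B) * (leg1 C * leg2 D) = leg1 A * (leg2 (emb B) * leg1 C) * leg2 D"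
    by (simp only: mult.assoc)
  then show ?thesis
    by (simp only: leg2_emb_commute leg1_mult leg2_mult mult.assoc)
qed

lemma leg1_leg2_emb_times:
  "leg1 A * leg2 B * (leg1 (emb C) * leg2 D) = leg1 (A * emb C) * leg2 (B * D)"
proof -
  have "leg1 A * leg2 B * (leg1 (emb C) * leg2 D) = leg1 A * (leg2 B * leg1 (emb C)) * leg2 D"
    by (simp only: mult.assoc)
  then show ?thesis
    by (simp only: leg1_emb_commute leg1_mult leg2_mult mult.assoc)
qed

lemma leg2_leg1_emb_times:
  "leg2 A * leg1 B * (leg1 C * leg2 (emb D)) = leg2 (A * emb D) * leg1 (B * C)"
proof -
  have "leg2 A * leg1 B * (leg1 C * leg2 (emb D)) = leg2 A * (leg1 (B * C) * leg2 (emb D))"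
    by (simp only: mult.assoc leg1_mult)
  then show ?thesis
    by (simp only: leg2_emb_commute[symmetric] leg2_mult mult.assoc)
qed

lemma leg2_leg1_times_emb:
  "leg1 (emb A) * leg2 B * (leg2 C * leg1 D) = leg2 (B * C) * leg1 (emb A * D)"
proof -
  have "leg1 (emb A) * leg2 B * (leg2 C * leg1 D) = leg1 (emb A) * leg2 (B * C) * leg1 D"
    by (simp only: mult.assoc leg2_mult)
  then show ?thesis
    by (simp only: leg1_emb_commute[symmetric] leg1_mult mult.assoc)
qed


section \<open>The semi-dynamical reflection equation\<close>

context
  fixes g L :: "('n::finite \<times> 'm::spectral_exponent, complex) oper"
    and b q :: "complex ^ 'n \<Rightarrow> ('n \<times> 'm, complex) oper"
  assumes g_log: "is_log L g"
    and g_ad: "ad_factorizable L"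
    and b: "invertible_dyn_matrix1 b"
    and q: "invertible_dyn_matrix1 q"
begin

section \<open>The one-parameter group of \<open>g\<close> and the inverses in the
  parametrization\<close>

abbreviation (input) e :: "complex \<Rightarrow> ('n \<times> 'm, complex) oper" where
  "e s \<equiv> op_exp (op_scale s L)"

lemma exponentiable: "exponentiable (op_scale s L)"
  using g_log by (simp add: is_log_def)

lemmas e_add = exp_add[OF exponentiable]
lemmas e_minus = exp_minus[OF exponentiable]

lemma e_commute: "e s * e t = e t * e s"
  by (simp add: e_add[symmetric] add.commute)

lemma g_eq: "g = e 1"
  using g_log by (simp add: is_log_def op_scale_one)

lemma op_inv_e: "op_inv (e s) = e (- s)"
  by (intro op_inv_eqI e_minus)

lemma op_inv_g: "op_inv g = e (- 1)"
  by (simp add: g_eq op_inv_e)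

lemma g_inverse: "g * e (- 1) = 1" "e (- 1) * g = 1"
  using e_minus[of 1] by (simp_all add: g_eq)

lemma e_ad: "one_space_matrix X \<Longrightarrow> one_space_matrix (e s * X * e (- s))"
  using g_ad by (simp add: ad_factorizable_def op_inv_e)

lemma inverse_dyn:
  assumes "invertible_dyn_matrix1 f"
  shows "f lam * op_inv (f lam) = 1" "op_inv (f lam) * f lam = 1"
    "one_space_matrix (f lam)" "one_space_matrix (op_inv (f lam))"
proof -
  obtain Y where Y: "one_space_matrix Y" "f lam * Y = 1" "Y * f lam = 1"
    using assms by (auto simp: invertible_dyn_matrix1_def)
  then have "op_inv (f lam) = Y"
    by (intro op_inv_eqI)
  then show "f lam * op_inv (f lam) = 1" "op_inv (f lam) * f lam = 1" "one_space_matrix (op_inv (f lam))"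
    using Y by simp_all
  show "one_space_matrix (f lam)"
    using assms by (simp add: invertible_dyn_matrix1_def dyn_matrix1_def)
qed

lemmas b_inverse = inverse_dyn[OF b]
lemmas q_inverse = inverse_dyn[OF q]

lemma emb_inverse:
  "emb (b lam) * emb (op_inv (b lam)) = (1 :: ('n \<times> 'm, 'a::complex_algebra_1) oper)"
  "emb (op_inv (b lam)) * emb (b lam) = (1 :: ('n \<times> 'm, 'a::complex_algebra_1) oper)"
  "emb (q lam) * emb (op_inv (q lam)) = (1 :: ('n \<times> 'm, 'a::complex_algebra_1) oper)"
  "emb (op_inv (q lam)) * emb (q lam) = (1 :: ('n \<times> 'm, 'a::complex_algebra_1) oper)"
  "emb (e s) * emb (e (- s)) = (1 :: ('n \<times> 'm, 'a::complex_algebra_1) oper)"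
  "emb (e (- s)) * emb (e s) = (1 :: ('n \<times> 'm, 'a::complex_algebra_1) oper)"
  "emb g * emb (e (- 1)) = (1 :: ('n \<times> 'm, 'a::complex_algebra_1) oper)"
  "emb (e (- 1)) * emb g = (1 :: ('n \<times> 'm, 'a::complex_algebra_1) oper)"
  by (simp_all add: emb_mult[symmetric] b_inverse q_inverse e_minus g_inverse emb_one)

lemma emb_e_commute:
  "emb (e s) * emb (e t) = (emb (e t) * emb (e s) :: ('n \<times> 'm, 'a::complex_algebra_1) oper)"
  by (simp add: emb_mult[symmetric] e_commute)

lemma G_eq: "G_op L lam = leg1 (e (sigma lam)) * leg2 (e (sigma lam))"
  unfolding G_op_def by (rule exp_leg_sum[OF exponentiable])

lemma op_inv_G: "op_inv (G_op L lam) = leg1 (e (- sigma lam)) * leg2 (e (- sigma lam))"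
proof (rule op_inv_eqI)
  have "leg1 X * leg2 X * (leg1 Y * leg2 Y) = 1" if "X * Y = 1"
    for X Y :: "('n \<times> 'm, complex) oper"
    using leg1_leg2_times_emb[of X X Y Y] that by (simp add: emb_complex leg1_one leg2_one)
  then show "G_op L lam * (leg1 (e (- sigma lam)) * leg2 (e (- sigma lam))) = 1"
    "leg1 (e (- sigma lam)) * leg2 (e (- sigma lam)) * G_op L lam = 1"
    by (simp_all add: G_eq e_minus)
qed

lemma two_space_matrix_conj_G:
  assumes "two_space_matrix X"
  shows "two_space_matrix (op_inv (G_op L lam) * X * G_op L lam)"
proof -
  \<comment> \<open>Ad-factorizability is phrased with the inverse on the right, whereas the
    dressing has the inverse of \<open>G\<close> on the left; hence the sign.\<close>
  define s where "s = - sigma lam"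
  have "two_space_matrix (leg1 (e s) * (leg2 (e s) * X * leg2 (e (- s))) * leg1 (e (- s)))"
    using e_minus[of s]
    by (intro two_space_matrix_conj1 two_space_matrix_conj2 e_ad assms)
  moreover have "leg1 (e s) * (leg2 (e s) * X * leg2 (e (- s))) * leg1 (e (- s))
      = leg1 (e s) * leg2 (e s) * X * (leg1 (e (- s)) * leg2 (e (- s)))"
    by (simp add: mult.assoc leg_complex_commute)
  ultimately show ?thesis
    unfolding op_inv_G by (simp add: G_eq s_def)
qed

lemma op_inv_shift_q:
  "op_inv (shift_h2 (\<lambda>mu. leg1 (q mu)) lam) = shift_h2 (\<lambda>mu. leg1 (op_inv (q mu))) lam"
  by (rule op_inv_eqI) (simp_all add: shift_h2_leg1_mult q_inverse leg1_one shift_h2_one)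

lemma op_inv_conj_b: "op_inv (leg2 g * leg2 (b lam) * op_inv (leg2 g)) = leg2 (g * op_inv (b lam) * e (- 1))"
proof -
  have "leg2 g * leg2 (b lam) * op_inv (leg2 g) = leg2 (g * b lam * e (- 1))"
    by (simp add: op_inv_leg2[OF g_inverse] leg2_mult)
  moreover have "g * b lam * e (- 1) * (g * op_inv (b lam) * e (- 1))
      = g * (b lam * (e (- 1) * g) * op_inv (b lam)) * e (- 1)"
    "g * op_inv (b lam) * e (- 1) * (g * b lam * e (- 1))
      = g * (op_inv (b lam) * (e (- 1) * g) * b lam) * e (- 1)"
    by (simp_all only: mult.assoc)
  then have "op_inv (leg2 (g * b lam * e (- 1))) = leg2 (g * op_inv (b lam) * e (- 1))"
    by (intro op_inv_leg2) (simp_all add: g_inverse b_inverse)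
  ultimately show ?thesis
    by simp
qed

lemmas op_inv_legs = op_inv_leg1[OF g_inverse] op_inv_leg2[OF g_inverse]
  op_inv_leg1[OF b_inverse(1,2)] op_inv_leg2[OF b_inverse(1,2)]
  op_inv_leg1[OF q_inverse(1,2)] op_inv_leg2[OF q_inverse(1,2)]

section \<open>The coefficients and \<open>K\<close> are matrices\<close>

lemma conj_g_ad: "one_space_matrix X \<Longrightarrow> one_space_matrix (g * X * e (- 1))"
  using e_ad[of X 1] by (simp add: g_eq)

text \<open>\<open>g\<close> itself need not be a matrix, so in this and the following lemmas each
  \<open>g\<close> stays grouped with its inverse as a conjugation.\<close>

lemma dyn_matrix2_A:
  assumes "dyn_matrix2 R0"
  shows "dyn_matrix2 (A_mat g L b R0)"
  unfolding dyn_matrix2_def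
proof
  fix lam
  have "leg1 g * leg1 (b lam) * op_inv (leg1 g) = leg1 (g * b lam * e (- 1))"
    by (simp add: op_inv_legs leg1_mult)
  then show "two_space_matrix (A_mat g L b R0 lam)"
    unfolding A_mat_def op_inv_conj_b op_inv_legs(3)
    using assms
    by (simp only:) (intro two_space_matrix_mult two_space_matrix_leg1 two_space_matrix_leg2
        two_space_matrix_conj_G conj_g_ad b_inverse, simp add: dyn_matrix2_def)
qed

lemma dyn_matrix2_B: "dyn_matrix2 (B_mat g b)"
  unfolding dyn_matrix2_def
proof
  fix lam
  have "two_space_matrix (leg2 (op_inv (b lam)) *
      (leg2 g * shift_h1 (\<lambda>mu. leg2 (b mu)) lam * leg2 (e (- 1))))"
    by (intro two_space_matrix_mult two_space_matrix_leg2 b_inverse two_space_matrix_conj2 g_inverse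
        conj_g_ad two_space_matrix_shift_h1)
  then show "two_space_matrix (B_mat g b lam)"
    by (simp add: B_mat_def op_inv_legs mult.assoc)
qed

lemma dyn_matrix2_C: "dyn_matrix2 (C_mat g b)"
  unfolding dyn_matrix2_def
proof
  fix lam
  have "two_space_matrix (leg1 (op_inv (b lam)) *
      (leg1 g * shift_h2 (\<lambda>mu. leg1 (b mu)) lam * leg1 (e (- 1))))"
    by (intro two_space_matrix_mult two_space_matrix_leg1 b_inverse two_space_matrix_conj1 g_inverse
        conj_g_ad two_space_matrix_shift_h2)
  then show "two_space_matrix (C_mat g b lam)"
    by (simp add: C_mat_def op_inv_legs mult.assoc)
qed

lemma dyn_matrix2_D:
  assumes "dyn_matrix2 Rbar"
  shows "dyn_matrix2 (D_mat L q Rbar)"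
  unfolding dyn_matrix2_def D_mat_def op_inv_shift_q op_inv_legs(6)
  using assms
  by (intro allI two_space_matrix_mult two_space_matrix_leg1 two_space_matrix_leg2
        two_space_matrix_shift_h1 two_space_matrix_shift_h2 two_space_matrix_conj_G q_inverse)
    (simp add: dyn_matrix2_def)

lemma dyn_matrix1_K:
  fixes Q0 :: "complex ^ 'n \<Rightarrow> ('n \<times> 'm, 'a::complex_algebra_1) oper"
  assumes "dyn_matrix1 Q0"
  shows "dyn_matrix1 (K_mat g L b q Q0)"
  unfolding dyn_matrix1_def
proof
  fix lam
  \<comment> \<open>The double negation exhibits the dressing as conjugation by \<open>e s\<close>
    with \<open>s = - sigma lam\<close>.\<close>
  have "one_space_matrix (emb (e (- sigma lam)) * Q0 lam * emb (e (- (- sigma lam))))"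
    by (rule one_space_matrix_conj)
      (use assms e_minus[of "- sigma lam"] e_ad[of _ "- sigma lam"] in \<open>simp_all add: dyn_matrix1_def\<close>)
  moreover have "one_space_matrix (emb (g * op_inv (b lam) * e (- 1)) :: ('n \<times> 'm, 'a) oper)"
    by (intro one_space_matrix_emb conj_g_ad b_inverse)
  moreover have "one_space_matrix (emb (q lam) :: ('n \<times> 'm, 'a) oper)"
    by (intro one_space_matrix_emb q_inverse)
  ultimately show "one_space_matrix (K_mat g L b q Q0 lam)"
    by (simp add: K_mat_def op_inv_g one_space_matrix_mult)
qed

section \<open>The dressed matrix and the reflection equation\<close>

context
  fixes Q0 :: "complex ^ 'n \<Rightarrow> ('n \<times> 'm, 'a::complex_algebra_1) oper"
    and R0 Rbar :: "complex ^ 'n \<Rightarrow> (('n \<times> 'm) \<times> ('n \<times> 'm), complex) oper"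
  assumes sol: "nondyn_solution g R0 Rbar Q0"
begin

definition dressed_Q :: "complex ^ 'n \<Rightarrow> ('n \<times> 'm, 'a) oper" where
  "dressed_Q lam = emb (e (- sigma lam)) * Q0 lam * emb (e (sigma lam))"

abbreviation (input) Qg :: "complex ^ 'n \<Rightarrow> ('n \<times> 'm, 'a) oper" where
  "Qg lam \<equiv> emb (e (- 1)) * dressed_Q lam * emb g"

abbreviation (input) conj_G where
  "conj_G R lam \<equiv> emb (op_inv (G_op L lam) * R * G_op L lam) :: (('n \<times> 'm) \<times> ('n \<times> 'm), 'a) oper"

text \<open>All coordinates enter \<open>sigma\<close> with weight 1, so the result is the same for
  every direction \<open>i\<close>.\<close>

lemma Q_shift: "dressed_Q (lam + axis i 1) = Qg lam"
proof -
  have "e (- (sigma lam + 1)) = e (- 1) * e (- sigma lam)" "e (sigma lam + 1) = e (sigma lam) * g"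
    using e_add[of "- sigma lam" "- 1"] e_add[of "sigma lam" 1] e_commute[of "- 1" "- sigma lam"]
    by (simp_all add: g_eq)
  moreover have "Q0 (lam + axis i 1) = Q0 lam"
    using sol by (simp add: nondyn_solution_def nondynamical_def)
  ultimately show ?thesis
    by (simp add: dressed_Q_def sigma_shift emb_mult mult.assoc)
qed

text \<open>\<open>g\<close> belongs to the same one-parameter group as the dressing, so undressing
  \<open>Qg lam\<close> yields \<open>?V\<close>, the conjugate of \<open>Q0 lam\<close> by
  \<open>g\<close> that occurs in the non-dynamical equation.\<close>

lemma Q_equation:
  "conj_G (R0 lam) lam * leg1 (dressed_Q lam) * leg2 (Qg lam)
    = leg2 (dressed_Q lam) * leg1 (Qg lam) * conj_G (Rbar lam) lam"
proof -
  let ?E = "emb (e (sigma lam)) :: ('n \<times> 'm, 'a) oper"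
  let ?E' = "emb (e (- sigma lam)) :: ('n \<times> 'm, 'a) oper"
  let ?V = "emb (e (- 1)) * Q0 lam * emb g"
  have EQ: "?E * dressed_Q lam = Q0 lam * ?E" and QE: "dressed_Q lam * ?E' = ?E' * Q0 lam"
    by (simp_all only: dressed_Q_def mult.assoc emb_inverse mult_1_right)
      (simp only: mult.assoc[symmetric] emb_inverse mult_1_left)
  have EW: "?E * Qg lam = ?V * ?E"
  proof -
    have "?E * Qg lam = (?E * emb (e (- 1))) * dressed_Q lam * emb g"
      by (simp only: mult.assoc)
    also have "\<dots> = emb (e (- 1)) * (?E * dressed_Q lam) * emb g"
      by (simp only: mult.assoc emb_e_commute[of "sigma lam" "- 1"])
    also have "\<dots> = emb (e (- 1)) * Q0 lam * (?E * emb g)"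
      by (simp only: mult.assoc EQ)
    also have "?E * emb g = emb g * ?E"
      unfolding g_eq by (rule emb_e_commute)
    finally show ?thesis by (simp only: mult.assoc)
  qed
  have WE: "Qg lam * ?E' = ?E' * ?V"
  proof -
    have "emb g * ?E' = ?E' * emb g"
      unfolding g_eq by (rule emb_e_commute)
    then have "Qg lam * ?E' = emb (e (- 1)) * (dressed_Q lam * ?E') * emb g"
      by (simp only: mult.assoc)
    also have "\<dots> = (emb (e (- 1)) * ?E') * Q0 lam * emb g"
      by (simp only: mult.assoc QE)
    also have "emb (e (- 1)) * ?E' = ?E' * emb (e (- 1))"
      by (rule emb_e_commute)
    finally show ?thesis by (simp only: mult.assoc)
  qed
  have eq: "emb (R0 lam) * (leg1 (Q0 lam) * leg2 ?V) = leg2 (Q0 lam) * leg1 ?V * emb (Rbar lam)"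
    using sol
    by (simp add: nondyn_solution_def op_inv_legs emb_leg1 emb_leg2 leg1_mult leg2_mult mult.assoc)
  have G: "emb (G_op L lam) = leg1 ?E * leg2 ?E"
    "emb (op_inv (G_op L lam)) = leg1 ?E' * leg2 ?E'"
    unfolding op_inv_G by (simp_all only: G_eq emb_mult emb_leg1 emb_leg2)
  \<comment> \<open>\<open>G\<close> is carried to the right through both factors, which undresses
    them; after \<open>eq\<close> its inverse is carried to the right and dresses them
    again.\<close>
  have "conj_G (R0 lam) lam * leg1 (dressed_Q lam) * leg2 (Qg lam)
      = leg1 ?E' * leg2 ?E' * emb (R0 lam) * (leg1 ?E * leg2 ?E * (leg1 (dressed_Q lam) * leg2 (Qg lam)))"
    by (simp only: emb_mult G mult.assoc)
  also have "leg1 ?E * leg2 ?E * (leg1 (dressed_Q lam) * leg2 (Qg lam)) = leg1 (Q0 lam * ?E) * leg2 (?V * ?E)"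
    by (simp only: leg1_leg2_times_emb EQ EW)
  also have "\<dots> = leg1 (Q0 lam) * leg2 ?V * (leg1 ?E * leg2 ?E)"
    by (simp only: leg1_leg2_emb_times)
  also have "leg1 ?E' * leg2 ?E' * emb (R0 lam) * (leg1 (Q0 lam) * leg2 ?V * (leg1 ?E * leg2 ?E))
      = leg1 ?E' * leg2 ?E' * (emb (R0 lam) * (leg1 (Q0 lam) * leg2 ?V)) * (leg1 ?E * leg2 ?E)"
    by (simp only: mult.assoc)
  also have "\<dots> = leg1 ?E' * leg2 ?E' * (leg2 (Q0 lam) * leg1 ?V) * emb (Rbar lam) * (leg1 ?E * leg2 ?E)"
    by (simp only: eq) (simp only: mult.assoc)
  also have "leg1 ?E' * leg2 ?E' * (leg2 (Q0 lam) * leg1 ?V) = leg2 (?E' * Q0 lam) * leg1 (?E' * ?V)"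
    by (rule leg2_leg1_times_emb)
  also have "\<dots> = leg2 (dressed_Q lam) * leg1 (Qg lam) * (leg1 ?E' * leg2 ?E')"
    by (simp only: leg2_leg1_emb_times QE WE)
  finally show ?thesis
    by (simp only: emb_mult G mult.assoc)
qed

abbreviation (input) K where "K \<equiv> K_mat g L b q Q0"

lemma K_eq: "K lam = emb (g * op_inv (b lam) * e (- 1)) * dressed_Q lam * emb (q lam)"
  by (simp add: K_mat_def dressed_Q_def op_inv_g)

text \<open>\<open>K\<close> begins with the \<open>g\<close>-conjugate of the inverse of
  \<open>b\<close>. The factor cancelling it comes from \<open>A\<close> at the argument
  \<open>lam\<close>, and from \<open>B\<close> and \<open>C\<close> at the shifted
  arguments.\<close>

lemma conj_b_K: "emb (g * b lam * e (- 1)) * K lam = dressed_Q lam * emb (q lam)"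
proof -
  have "emb (g * b lam * e (- 1)) * K lam
      = emb (g * (b lam * (e (- 1) * g) * op_inv (b lam)) * e (- 1)) * dressed_Q lam * emb (q lam)"
    by (simp only: K_eq emb_mult mult.assoc)
  then show ?thesis
    by (simp add: g_inverse b_inverse emb_one)
qed

lemma shifted_K1:
  "leg2 (emb g) * shift_h1 (\<lambda>mu. leg2 (emb (b mu))) lam * leg2 (emb (e (- 1)))
      * shift_h1 (\<lambda>mu. leg2 (K mu)) lam
    = leg2 (Qg lam) * shift_h1 (\<lambda>mu. leg2 (emb (q mu))) lam"
proof -
  have "leg2 (emb g) * shift_h1 (\<lambda>mu. leg2 (emb (b mu))) lam * leg2 (emb (e (- 1)))
      * shift_h1 (\<lambda>mu. leg2 (K mu)) lam = shift_h1 (\<lambda>mu. leg2 (dressed_Q mu * emb (q mu))) lam"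
    by (simp only: shift_h1_leg2_mult emb_mult[symmetric] conj_b_K)
  \<comment> \<open>Being independent of the direction, the shifted dressed matrix leaves the sum;
    only \<open>q\<close> stays shifted.\<close>
  also have "\<dots> = shift_h1 (\<lambda>mu. leg2 (Qg lam * emb (q mu))) lam"
    by (simp only: shift_h1_def Q_shift)
  finally show ?thesis
    by (simp only: shift_h1_leg2_mult)
qed

lemma shifted_K2:
  "leg1 (emb g) * shift_h2 (\<lambda>mu. leg1 (emb (b mu))) lam * leg1 (emb (e (- 1)))
      * shift_h2 (\<lambda>mu. leg1 (K mu)) lam
    = leg1 (Qg lam) * shift_h2 (\<lambda>mu. leg1 (emb (q mu))) lam"
proof -
  have "leg1 (emb g) * shift_h2 (\<lambda>mu. leg1 (emb (b mu))) lam * leg1 (emb (e (- 1)))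
      * shift_h2 (\<lambda>mu. leg1 (K mu)) lam = shift_h2 (\<lambda>mu. leg1 (dressed_Q mu * emb (q mu))) lam"
    by (simp only: shift_h2_leg1_mult emb_mult[symmetric] conj_b_K)
  also have "\<dots> = shift_h2 (\<lambda>mu. leg1 (Qg lam * emb (q mu))) lam"
    by (simp only: shift_h2_def Q_shift)
  finally show ?thesis
    by (simp only: shift_h2_leg1_mult)
qed

lemma reflection_equation:
  "emb (A_mat g L b R0 lam) * leg1 (K lam) * emb (B_mat g b lam) * shift_h1 (\<lambda>mu. leg2 (K mu)) lam
    = leg2 (K lam) * emb (C_mat g b lam) * shift_h2 (\<lambda>mu. leg1 (K mu)) lam * emb (D_mat L q Rbar lam)"
proof -
  let ?b = "emb (b lam) :: ('n \<times> 'm, 'a) oper"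
  let ?b' = "emb (op_inv (b lam)) :: ('n \<times> 'm, 'a) oper"
  let ?q = "emb (q lam) :: ('n \<times> 'm, 'a) oper"
  let ?q' = "emb (op_inv (q lam)) :: ('n \<times> 'm, 'a) oper"
  let ?c = "emb (g * op_inv (b lam) * e (- 1)) :: ('n \<times> 'm, 'a) oper"
  let ?d = "emb (g * b lam * e (- 1)) :: ('n \<times> 'm, 'a) oper"
  let ?bh1 = "leg2 (emb g) * shift_h1 (\<lambda>mu. leg2 (emb (b mu))) lam * leg2 (emb (e (- 1)))
    :: (('n \<times> 'm) \<times> ('n \<times> 'm), 'a) oper"
  let ?bh2 = "leg1 (emb g) * shift_h2 (\<lambda>mu. leg1 (emb (b mu))) lam * leg1 (emb (e (- 1)))
    :: (('n \<times> 'm) \<times> ('n \<times> 'm), 'a) oper"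
  let ?Kh1 = "shift_h1 (\<lambda>mu. leg2 (K mu)) lam"
  let ?Kh2 = "shift_h2 (\<lambda>mu. leg1 (K mu)) lam"
  let ?qh1 = "shift_h1 (\<lambda>mu. leg2 (emb (q mu))) lam :: (('n \<times> 'm) \<times> ('n \<times> 'm), 'a) oper"
  let ?qh2 = "shift_h2 (\<lambda>mu. leg1 (emb (q mu))) lam :: (('n \<times> 'm) \<times> ('n \<times> 'm), 'a) oper"
  let ?qh2' = "shift_h2 (\<lambda>mu. leg1 (emb (op_inv (q mu)))) lam
    :: (('n \<times> 'm) \<times> ('n \<times> 'm), 'a) oper"
  have A: "emb (A_mat g L b R0 lam) = leg1 ?b' * leg2 ?c * conj_G (R0 lam) lam * (leg1 ?d * leg2 ?b)"
    unfolding A_mat_def op_inv_conj_b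
    by (simp only: op_inv_legs emb_mult emb_leg1 emb_leg2 leg1_mult leg2_mult mult.assoc)
  have B: "emb (B_mat g b lam) = leg2 ?b' * ?bh1"
    unfolding B_mat_def op_inv_legs
    by (simp only: emb_mult emb_leg2 emb_shift_h1 mult.assoc)
  have C: "emb (C_mat g b lam) = leg1 ?b' * ?bh2"
    unfolding C_mat_def op_inv_legs
    by (simp only: emb_mult emb_leg1 emb_shift_h2 mult.assoc)
  have D: "emb (D_mat L q Rbar lam) = ?qh2' * leg2 ?q' * conj_G (Rbar lam) lam * (leg1 ?q * ?qh1)"
    unfolding D_mat_def op_inv_shift_q op_inv_legs
    by (simp only: emb_mult emb_leg1 emb_leg2 emb_shift_h1 emb_shift_h2 mult.assoc)
  have qh2: "?qh2 * ?qh2' = 1"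
    by (simp only: shift_h2_leg1_mult emb_inverse leg1_one shift_h2_one)
  \<comment> \<open>The last factor of \<open>A\<close> has complex entries, so it crosses
    \<open>K_1\<close> and cancels the inverse at the start of \<open>B\<close>; the rest of
    \<open>B\<close> then meets the shifted \<open>K_2\<close>.\<close>
  have "emb (A_mat g L b R0 lam) * leg1 (K lam) * emb (B_mat g b lam) * ?Kh1
      = leg1 ?b' * leg2 ?c * conj_G (R0 lam) lam * (leg1 ?d * leg2 ?b * (leg1 (K lam) * leg2 ?b'))
        * (?bh1 * ?Kh1)"
    by (simp only: A B mult.assoc)
  also have "\<dots> = leg1 ?b' * leg2 ?c * conj_G (R0 lam) lam * leg1 (dressed_Q lam) * (leg1 ?q * leg2 (Qg lam)) * ?qh1"
    by (simp only: leg1_leg2_times_emb conj_b_K emb_inverse leg2_one mult_1_right shifted_K1)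
      (simp only: leg1_mult mult.assoc)
  also have "\<dots> = leg1 ?b' * leg2 ?c * (conj_G (R0 lam) lam * leg1 (dressed_Q lam) * leg2 (Qg lam)) * (leg1 ?q * ?qh1)"
    by (simp only: leg1_emb_commute[symmetric]) (simp only: mult.assoc)
  also have "\<dots> = leg1 ?b' * leg2 ?c * (leg2 (dressed_Q lam) * leg1 (Qg lam)) * conj_G (Rbar lam) lam * (leg1 ?q * ?qh1)"
    by (simp only: Q_equation) (simp only: mult.assoc)
  \<comment> \<open>Inserting \<open>?q * ?q'\<close> in leg 2 completes \<open>K_2\<close> and
    provides the unshifted inverse in \<open>D\<close>.\<close>
  also have "leg1 ?b' * leg2 ?c * (leg2 (dressed_Q lam) * leg1 (Qg lam))
      = leg2 (?c * dressed_Q lam * ?q) * (leg1 (?b' * Qg lam) * leg2 ?q')"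
  proof -
    have "leg2 (?c * dressed_Q lam * ?q) * (leg1 (?b' * Qg lam) * leg2 ?q')
        = leg2 (?c * dressed_Q lam * (?q * ?q')) * leg1 (?b' * Qg lam)"
      by (simp only: leg2_emb_commute[symmetric]) (simp only: leg2_mult mult.assoc)
    then show ?thesis
      by (simp only: leg2_leg1_times_emb emb_inverse mult_1_right)
  qed
  \<comment> \<open>Likewise \<open>?qh2 * ?qh2'\<close> is inserted: one half completes
    \<open>C\<close> times the shifted \<open>K_1\<close>, the other is the first factor of
    \<open>D\<close>.\<close>
  also have "leg2 (?c * dressed_Q lam * ?q) * (leg1 (?b' * Qg lam) * leg2 ?q') * conj_G (Rbar lam) lam * (leg1 ?q * ?qh1)
      = leg2 (K lam) * leg1 ?b' * (leg1 (Qg lam) * (?qh2 * ?qh2')) * leg2 ?q' * conj_G (Rbar lam) lam * (leg1 ?q * ?qh1)"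
    by (simp only: K_eq qh2 leg1_mult mult_1_right mult.assoc)
  also have "leg1 (Qg lam) * (?qh2 * ?qh2') = ?bh2 * ?Kh2 * ?qh2'"
    by (simp only: shifted_K2) (simp only: mult.assoc)
  finally show ?thesis
    by (simp only: C D mult.assoc)
qed

lemma semidyn_solution_K:
  assumes "dyn_matrix2 R0" "dyn_matrix2 Rbar"
  shows "semidyn_solution (A_mat g L b R0) (B_mat g b) (C_mat g b) (D_mat L q Rbar) K"
  using sol assms reflection_equation
  by (simp add: semidyn_solution_def dyn_matrix2_A dyn_matrix2_B dyn_matrix2_C dyn_matrix2_D
      dyn_matrix1_K nondyn_solution_def)

end

section \<open>The scalar solution from the identity\<close>

lemma nondyn_solution_one:
  "nondyn_solution g R R (\<lambda>_. 1 :: ('n \<times> 'm, 'a::complex_algebra_1) oper)"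
proof -
  have "leg2 (emb (e (- 1))) * leg2 (emb g) = (1 :: (('n \<times> 'm) \<times> ('n \<times> 'm), 'a) oper)"
    "leg1 (emb (e (- 1))) * leg1 (emb g) = (1 :: (('n \<times> 'm) \<times> ('n \<times> 'm), 'a) oper)"
    by (simp_all only: leg1_mult[symmetric] leg2_mult[symmetric] emb_inverse leg1_one leg2_one)
  then show ?thesis
    by (simp add: nondyn_solution_def dyn_matrix1_def nondynamical_def one_space_matrix_one
        leg1_one leg2_one op_inv_legs emb_leg1 emb_leg2 mult.assoc)
qed

lemma K_mat_one: "K_mat g L b q (\<lambda>_. 1) = (\<lambda>lam. g * op_inv (b lam) * op_inv g * q lam)"
  by (rule ext) (simp add: K_mat_def emb_complex e_minus)

lemma invertible_dyn_matrix1_K_one: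
  "invertible_dyn_matrix1 (\<lambda>lam. g * op_inv (b lam) * op_inv g * q lam)"
  unfolding invertible_dyn_matrix1_def dyn_matrix1_def op_inv_g
proof (intro conjI allI exI)
  fix lam
  \<comment> \<open>Inverse factors in reverse order, with the conjugate of \<open>b\<close> kept
    whole so that \<open>conj_g_ad\<close> shows it to be a matrix.\<close>
  let ?Y = "op_inv (q lam) * (g * b lam * e (- 1))"
  show "one_space_matrix (g * op_inv (b lam) * e (- 1) * q lam)" "one_space_matrix ?Y"
    by (intro one_space_matrix_mult conj_g_ad b_inverse q_inverse)+
  have "g * op_inv (b lam) * e (- 1) * q lam * ?Y
      = g * (op_inv (b lam) * (e (- 1) * (q lam * op_inv (q lam)) * g) * b lam) * e (- 1)"
    by (simp only: mult.assoc)
  then show "g * op_inv (b lam) * e (- 1) * q lam * ?Y = 1"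
    by (simp add: q_inverse g_inverse b_inverse)
  have "?Y * (g * op_inv (b lam) * e (- 1) * q lam)
      = op_inv (q lam) * (g * (b lam * (e (- 1) * g) * op_inv (b lam)) * e (- 1)) * q lam"
    by (simp only: mult.assoc)
  then show "?Y * (g * op_inv (b lam) * e (- 1) * q lam) = 1"
    by (simp add: q_inverse g_inverse b_inverse)
qed

end

theorem mainTheorem8:
  fixes g L :: "('n::finite \<times> 'm::spectral_exponent, complex) oper"
    and b q :: "complex ^ 'n \<Rightarrow> ('n \<times> 'm, complex) oper"
    and R0 Rbar :: "complex ^ 'n \<Rightarrow> (('n \<times> 'm) \<times> ('n \<times> 'm), complex) oper"
  assumes g_inv: "op_invertible g"
    and g_log: "is_log L g"
    and g_ad: "ad_factorizable L"
    and b: "invertible_dyn_matrix1 b"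
    and q: "invertible_dyn_matrix1 q"
    and R0: "dyn_matrix2 R0" "nondynamical R0"
    and Rbar: "dyn_matrix2 Rbar" "nondynamical Rbar"
    and R0_YBE: "\<And>lam. YBE_gg g (R0 lam)"
    and Rbar_YBE: "\<And>lam. YBE_gg g (Rbar lam)"
  shows "(\<forall>Q0 :: complex ^ 'n \<Rightarrow> ('n \<times> 'm, 'a::complex_algebra_1) oper.
      nondyn_solution g R0 Rbar Q0 \<longrightarrow>
      semidyn_solution (A_mat g L b R0) (B_mat g b) (C_mat g b) (D_mat L q Rbar)
        (K_mat g L b q Q0)) \<and>
    (R0 = Rbar \<longrightarrow>
      nondyn_solution g R0 Rbar (\<lambda>_. 1 :: ('n \<times> 'm, 'a) oper) \<and>
      invertible_dyn_matrix1 (\<lambda>_ :: complex ^ 'n. 1 :: ('n \<times> 'm, 'a) oper) \<and>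
      semidyn_solution (A_mat g L b R0) (B_mat g b) (C_mat g b) (D_mat L q Rbar)
        (\<lambda>lam. g * op_inv (b lam) * op_inv g * q lam) \<and>
      invertible_dyn_matrix1 (\<lambda>lam. g * op_inv (b lam) * op_inv g * q lam))"
proof (intro conjI impI allI)
  show "semidyn_solution (A_mat g L b R0) (B_mat g b) (C_mat g b) (D_mat L q Rbar) (K_mat g L b q Q0)"
    if "nondyn_solution g R0 Rbar Q0" for Q0 :: "complex ^ 'n \<Rightarrow> ('n \<times> 'm, 'a) oper"
    using g_log g_ad b q that R0(1) Rbar(1) by (rule semidyn_solution_K)
  assume "R0 = Rbar"
  then show "nondyn_solution g R0 Rbar (\<lambda>_. 1 :: ('n \<times> 'm, 'a) oper)"
    using nondyn_solution_one[OF g_log g_ad b q] by simp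
  show "invertible_dyn_matrix1 (\<lambda>_ :: complex ^ 'n. 1 :: ('n \<times> 'm, 'a) oper)"
    unfolding invertible_dyn_matrix1_def dyn_matrix1_def
    by (intro conjI allI exI[of _ 1] one_space_matrix_one) simp_all
  show "invertible_dyn_matrix1 (\<lambda>lam. g * op_inv (b lam) * op_inv g * q lam)"
    using g_log g_ad b q by (rule invertible_dyn_matrix1_K_one)
  \<comment> \<open>The scalar claim needs the identity at coefficient type \<open>complex\<close>,
    where \<open>emb\<close> does nothing and the dressing cancels.\<close>
  have "nondyn_solution g R0 Rbar (\<lambda>_. 1 :: ('n \<times> 'm, complex) oper)"
    using nondyn_solution_one[OF g_log g_ad b q] \<open>R0 = Rbar\<close> by simp
  from semidyn_solution_K[OF g_log g_ad b q this R0(1) Rbar(1)]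
  show "semidyn_solution (A_mat g L b R0) (B_mat g b) (C_mat g b) (D_mat L q Rbar)
      (\<lambda>lam. g * op_inv (b lam) * op_inv g * q lam)"
    by (simp only: K_mat_one[OF g_log g_ad b q])
qed

end
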